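(* Let $\mathcal{S}$ be a geometric universe with a later modality structure $(\triangleright,\mathsf{next})$, and let $L:\mathcal{S}\to\mathcal{T}$ be a left exact localization. If $(\triangleright,\mathsf{next})$ supports Löb induction, then so does the localized later modality structure $(\triangleright_L,\mathsf{next}_L)$ on $\mathcal{T}$. Hence if $\mathcal{S}$ is an elementary geometric model of synthetic guarded domain theory, then so is any left exact localization $\mathcal{T}$ of $\mathcal{S}$ (with the localized later modality structure).
   Context: A geometric universe is an elementary topos with a natural numbers object; $\Omega$ denotes its subobject classifier. A morphism of geometric universes $L:\mathcal{S}\to\mathcal{T}$ is a left exact functor $L^*:\mathcal{S}\to\mathcal{T}$ equipped with a right adjoint $\Gamma_L:\mathcal{T}\to\mathcal{S}$; it is a left exact localization when $\Gamma_L$ is fully faithful. A later modality structure on a geometric universe $\mathcal{S}$ is a left exact endofunctor $\triangleright:\mathcal{S}\to\mathcal{S}$ with a natural transformation $\mathsf{next}:\mathrm{Id}\to\triangleright$. It is well-pointed when $\triangleright(\mathsf{next}_A)=\mathsf{next}_{\triangleright A}$ for all objects $A$. It internalizes as $\triangleright:\Omega\to\Omega$: if $\phi:X\to\Omega$ classifies $U\hookrightarrow X$, then $\triangleright\phi$ classifies the pullback of $\triangleright U\hookrightarrow\triangleright X$ along $\mathsf{next}_X$. It supports Löb induction when the sequent $\phi:\Omega\mid(\triangleright\phi\Rightarrow\phi)\vdash\phi$ holds in the internal logic. An elementary geometric model of synthetic guarded domain theory is a geometric universe equipped with a well-pointed later modality structure that supports Löb induction. Given a left exact localization $L$ and a later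 modality structure $(\triangleright,\mathsf{next})$ on $\mathcal{S}$, the localized structure on $\mathcal{T}$ is defined by $\triangleright_L A=L^*(\triangleright(\Gamma_L A))$ and $(\mathsf{next}_L)_A=L^*(\mathsf{next}_{\Gamma_L A})\circ\epsilon_A^{-1}$, where $\epsilon:L^*\Gamma_L\to\mathrm{Id}_{\mathcal{T}}$ is the (invertible) counit of $L^*\dashv\Gamma_L$. *)

theory Defs
  imports Main
begin

section \<open>Categories, functors and natural transformations\<close>

text \<open>Objects and arrows are carrier sets inside arbitrary types; the values of the operations and
  of functors outside the carriers are irrelevant.\<close>

record ('o, 'm) precategory =
  Obj :: "'o set"
  Arr :: "'m set"
  Dom :: "'m \<Rightarrow> 'o"
  Cod :: "'m \<Rightarrow> 'o"
  Ident :: "'o \<Rightarrow> 'm"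
  Comp :: "'m \<Rightarrow> 'm \<Rightarrow> 'm"  (infixr "\<cdot>\<index>" 70)

definition hom :: "('o, 'm) precategory \<Rightarrow> 'o \<Rightarrow> 'o \<Rightarrow> 'm set" where
  "hom C A B = {f \<in> Arr C. Dom C f = A \<and> Cod C f = B}"

locale category =
  fixes C :: "('o, 'm) precategory" (structure)
  assumes dom_obj: "f \<in> Arr C \<Longrightarrow> Dom C f \<in> Obj C"
    and cod_obj: "f \<in> Arr C \<Longrightarrow> Cod C f \<in> Obj C"
    and ident_hom: "A \<in> Obj C \<Longrightarrow> Ident C A \<in> hom C A A"
    and comp_hom: "\<lbrakk>f \<in> hom C A B; g \<in> hom C B D\<rbrakk> \<Longrightarrow> g \<cdot> f \<in> hom C A D"
    and comp_ident: "f \<in> hom C A B \<Longrightarrow> f \<cdot> Ident C A = f"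
    and ident_comp: "f \<in> hom C A B \<Longrightarrow> Ident C B \<cdot> f = f"
    and comp_assoc:
      "\<lbrakk>f \<in> hom C A B; g \<in> hom C B D; h \<in> hom C D E\<rbrakk> \<Longrightarrow> (h \<cdot> g) \<cdot> f = h \<cdot> (g \<cdot> f)"

definition mono_arr :: "('o, 'm) precategory \<Rightarrow> 'm \<Rightarrow> bool" where
  "mono_arr C m \<longleftrightarrow> m \<in> Arr C \<and>
     (\<forall>X\<in>Obj C. \<forall>f\<in>hom C X (Dom C m). \<forall>g\<in>hom C X (Dom C m).
        m \<cdot>\<^bsub>C\<^esub> f = m \<cdot>\<^bsub>C\<^esub> g \<longrightarrow> f = g)"

definition inverse_arr :: "('o, 'm) precategory \<Rightarrow> 'm \<Rightarrow> 'm" where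
  "inverse_arr C f = (THE g. g \<in> hom C (Cod C f) (Dom C f) \<and>
     g \<cdot>\<^bsub>C\<^esub> f = Ident C (Dom C f) \<and> f \<cdot>\<^bsub>C\<^esub> g = Ident C (Cod C f))"

record ('o, 'm, 'p, 'n) functor_data =
  on_obj :: "'o \<Rightarrow> 'p"
  on_arr :: "'m \<Rightarrow> 'n"

definition is_functor ::
  "('o, 'm) precategory \<Rightarrow> ('p, 'n) precategory \<Rightarrow> ('o, 'm, 'p, 'n) functor_data \<Rightarrow> bool" where
  "is_functor C D F \<longleftrightarrow>
     (\<forall>A\<in>Obj C. on_obj F A \<in> Obj D) \<and>
     (\<forall>A B. \<forall>f\<in>hom C A B. on_arr F f \<in> hom D (on_obj F A) (on_obj F B)) \<and>
     (\<forall>A\<in>Obj C. on_arr F (Ident C A) = Ident D (on_obj F A)) \<and>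
     (\<forall>A B E. \<forall>f\<in>hom C A B. \<forall>g\<in>hom C B E.
        on_arr F (g \<cdot>\<^bsub>C\<^esub> f) = on_arr F g \<cdot>\<^bsub>D\<^esub> on_arr F f)"

definition id_functor :: "('o, 'm, 'o, 'm) functor_data" where
  "id_functor = \<lparr>on_obj = (\<lambda>A. A), on_arr = (\<lambda>f. f)\<rparr>"

definition comp_functor ::
  "('p, 'n, 'q, 'k) functor_data \<Rightarrow> ('o, 'm, 'p, 'n) functor_data \<Rightarrow> ('o, 'm, 'q, 'k) functor_data"
  (infixr "\<circ>\<^sub>F" 55) where
  "G \<circ>\<^sub>F F = \<lparr>on_obj = (\<lambda>A. on_obj G (on_obj F A)), on_arr = (\<lambda>f. on_arr G (on_arr F f))\<rparr>"

definition fully_faithful ::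
  "('o, 'm) precategory \<Rightarrow> ('p, 'n) precategory \<Rightarrow> ('o, 'm, 'p, 'n) functor_data \<Rightarrow> bool" where
  "fully_faithful C D F \<longleftrightarrow> is_functor C D F \<and>
     (\<forall>A\<in>Obj C. \<forall>B\<in>Obj C.
        bij_betw (on_arr F) (hom C A B) (hom D (on_obj F A) (on_obj F B)))"

definition nat_trans ::
  "('o, 'm) precategory \<Rightarrow> ('p, 'n) precategory \<Rightarrow> ('o, 'm, 'p, 'n) functor_data \<Rightarrow>
   ('o, 'm, 'p, 'n) functor_data \<Rightarrow> ('o \<Rightarrow> 'n) \<Rightarrow> bool" where
  "nat_trans C D F G \<alpha> \<longleftrightarrow>
     (\<forall>A\<in>Obj C. \<alpha> A \<in> hom D (on_obj F A) (on_obj G A)) \<and>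
     (\<forall>A B. \<forall>f\<in>hom C A B. \<alpha> B \<cdot>\<^bsub>D\<^esub> on_arr F f = on_arr G f \<cdot>\<^bsub>D\<^esub> \<alpha> A)"

section \<open>Finite limits and left exact functors\<close>

definition cone ::
  "('o, 'm) precategory \<Rightarrow> ('i, 'j) precategory \<Rightarrow> ('i, 'j, 'o, 'm) functor_data \<Rightarrow>
   'o \<Rightarrow> ('i \<Rightarrow> 'm) \<Rightarrow> bool" where
  "cone C J F A \<pi> \<longleftrightarrow> A \<in> Obj C \<and>
     (\<forall>i\<in>Obj J. \<pi> i \<in> hom C A (on_obj F i)) \<and>
     (\<forall>i k. \<forall>u\<in>hom J i k. on_arr F u \<cdot>\<^bsub>C\<^esub> \<pi> i = \<pi> k)"

definition limit_cone ::
  "('o, 'm) precategory \<Rightarrow> ('i, 'j) precategory \<Rightarrow> ('i, 'j, 'o, 'm) functor_data \<Rightarrow>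
   'o \<Rightarrow> ('i \<Rightarrow> 'm) \<Rightarrow> bool" where
  "limit_cone C J F A \<pi> \<longleftrightarrow> cone C J F A \<pi> \<and>
     (\<forall>X \<rho>. cone C J F X \<rho> \<longrightarrow>
        (\<exists>!h. h \<in> hom C X A \<and> (\<forall>i\<in>Obj J. \<pi> i \<cdot>\<^bsub>C\<^esub> h = \<rho> i)))"

text \<open>Finite shapes are drawn from the type \<^typ>\<open>nat\<close>; every finite category is isomorphic to one of
  these.\<close>

definition finite_shape :: "(nat, nat) precategory \<Rightarrow> bool" where
  "finite_shape J \<longleftrightarrow> category J \<and> finite (Obj J) \<and> finite (Arr J)"

definition has_finite_limits :: "('o, 'm) precategory \<Rightarrow> bool" where
  "has_finite_limits C \<longleftrightarrow>
     (\<forall>J F. finite_shape J \<and> is_functor J C F \<longrightarrow> (\<exists>A \<pi>. limit_cone C J F A \<pi>))"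

definition left_exact ::
  "('o, 'm) precategory \<Rightarrow> ('p, 'n) precategory \<Rightarrow> ('o, 'm, 'p, 'n) functor_data \<Rightarrow> bool" where
  "left_exact C D F \<longleftrightarrow> is_functor C D F \<and>
     (\<forall>J K A \<pi>. finite_shape J \<and> is_functor J C K \<and> limit_cone C J K A \<pi> \<longrightarrow>
        limit_cone D J (F \<circ>\<^sub>F K) (on_obj F A) (\<lambda>i. on_arr F (\<pi> i)))"

section \<open>Elementary toposes with a natural numbers object\<close>

definition terminal :: "('o, 'm) precategory \<Rightarrow> 'o \<Rightarrow> bool" where
  "terminal C A \<longleftrightarrow> A \<in> Obj C \<and> (\<forall>X\<in>Obj C. \<exists>!f. f \<in> hom C X A)"

definition is_equalizer :: "('o, 'm) precategory \<Rightarrow> 'm \<Rightarrow> 'm \<Rightarrow> 'm \<Rightarrow> bool" where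
  "is_equalizer C e f g \<longleftrightarrow>
     (\<exists>E A B. e \<in> hom C E A \<and> f \<in> hom C A B \<and> g \<in> hom C A B \<and> f \<cdot>\<^bsub>C\<^esub> e = g \<cdot>\<^bsub>C\<^esub> e \<and>
        (\<forall>X\<in>Obj C. \<forall>a\<in>hom C X A. f \<cdot>\<^bsub>C\<^esub> a = g \<cdot>\<^bsub>C\<^esub> a \<longrightarrow>
           (\<exists>!h. h \<in> hom C X E \<and> e \<cdot>\<^bsub>C\<^esub> h = a)))"

text \<open>\<open>is_pullback C p q f g\<close>: the square \<open>f \<cdot> p = g \<cdot> q\<close> is a pullback; in particular \<open>p\<close> is a
  pullback of \<open>g\<close> along \<open>f\<close>.\<close>

definition is_pullback :: "('o, 'm) precategory \<Rightarrow> 'm \<Rightarrow> 'm \<Rightarrow> 'm \<Rightarrow> 'm \<Rightarrow> bool" where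
  "is_pullback C p q f g \<longleftrightarrow>
     (\<exists>P A B Z. p \<in> hom C P A \<and> q \<in> hom C P B \<and> f \<in> hom C A Z \<and> g \<in> hom C B Z \<and>
        f \<cdot>\<^bsub>C\<^esub> p = g \<cdot>\<^bsub>C\<^esub> q \<and>
        (\<forall>X\<in>Obj C. \<forall>a\<in>hom C X A. \<forall>b\<in>hom C X B. f \<cdot>\<^bsub>C\<^esub> a = g \<cdot>\<^bsub>C\<^esub> b \<longrightarrow>
           (\<exists>!h. h \<in> hom C X P \<and> p \<cdot>\<^bsub>C\<^esub> h = a \<and> q \<cdot>\<^bsub>C\<^esub> h = b)))"

definition is_product :: "('o, 'm) precategory \<Rightarrow> 'o \<Rightarrow> 'o \<Rightarrow> 'o \<Rightarrow> 'm \<Rightarrow> 'm \<Rightarrow> bool" where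
  "is_product C A B P p q \<longleftrightarrow> p \<in> hom C P A \<and> q \<in> hom C P B \<and>
     (\<forall>X\<in>Obj C. \<forall>a\<in>hom C X A. \<forall>b\<in>hom C X B.
        \<exists>!h. h \<in> hom C X P \<and> p \<cdot>\<^bsub>C\<^esub> h = a \<and> q \<cdot>\<^bsub>C\<^esub> h = b)"

text \<open>A chosen product cone on each pair of objects.\<close>

definition prod_cone :: "('o, 'm) precategory \<Rightarrow> 'o \<Rightarrow> 'o \<Rightarrow> 'o \<times> 'm \<times> 'm" where
  "prod_cone C A B = (SOME (P, p, q). is_product C A B P p q)"

definition prod_obj :: "('o, 'm) precategory \<Rightarrow> 'o \<Rightarrow> 'o \<Rightarrow> 'o" where
  "prod_obj C A B = fst (prod_cone C A B)"

definition proj1 :: "('o, 'm) precategory \<Rightarrow> 'o \<Rightarrow> 'o \<Rightarrow> 'm" where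
  "proj1 C A B = fst (snd (prod_cone C A B))"

definition proj2 :: "('o, 'm) precategory \<Rightarrow> 'o \<Rightarrow> 'o \<Rightarrow> 'm" where
  "proj2 C A B = snd (snd (prod_cone C A B))"

definition pairing :: "('o, 'm) precategory \<Rightarrow> 'm \<Rightarrow> 'm \<Rightarrow> 'm" where
  "pairing C f g = (THE h.
     h \<in> hom C (Dom C f) (prod_obj C (Cod C f) (Cod C g)) \<and>
     proj1 C (Cod C f) (Cod C g) \<cdot>\<^bsub>C\<^esub> h = f \<and> proj2 C (Cod C f) (Cod C g) \<cdot>\<^bsub>C\<^esub> h = g)"

definition is_exponential :: "('o, 'm) precategory \<Rightarrow> 'o \<Rightarrow> 'o \<Rightarrow> 'o \<Rightarrow> 'm \<Rightarrow> bool" where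
  "is_exponential C A B E ev \<longleftrightarrow> E \<in> Obj C \<and> ev \<in> hom C (prod_obj C E A) B \<and>
     (\<forall>X\<in>Obj C. \<forall>f\<in>hom C (prod_obj C X A) B.
        \<exists>!g. g \<in> hom C X E \<and>
          ev \<cdot>\<^bsub>C\<^esub> pairing C (g \<cdot>\<^bsub>C\<^esub> proj1 C X A) (proj2 C X A) = f)"

definition is_subobject_classifier :: "('o, 'm) precategory \<Rightarrow> 'm \<Rightarrow> bool" where
  "is_subobject_classifier C t \<longleftrightarrow> t \<in> Arr C \<and> terminal C (Dom C t) \<and>
     (\<forall>m. mono_arr C m \<longrightarrow>
        (\<exists>!\<chi>. \<chi> \<in> hom C (Cod C m) (Cod C t) \<and> (\<exists>b. is_pullback C m b \<chi> t)))"

definition is_nno :: "('o, 'm) precategory \<Rightarrow> 'o \<Rightarrow> 'm \<Rightarrow> 'm \<Rightarrow> bool" where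
  "is_nno C N z s \<longleftrightarrow>
     terminal C (Dom C z) \<and> z \<in> hom C (Dom C z) N \<and> s \<in> hom C N N \<and>
     (\<forall>X\<in>Obj C. \<forall>x\<in>hom C (Dom C z) X. \<forall>u\<in>hom C X X.
        \<exists>!f. f \<in> hom C N X \<and> f \<cdot>\<^bsub>C\<^esub> z = x \<and> f \<cdot>\<^bsub>C\<^esub> s = u \<cdot>\<^bsub>C\<^esub> f)"

definition elementary_topos :: "('o, 'm) precategory \<Rightarrow> bool" where
  "elementary_topos C \<longleftrightarrow> category C \<and> has_finite_limits C \<and>
     (\<forall>A\<in>Obj C. \<forall>B\<in>Obj C. \<exists>E ev. is_exponential C A B E ev) \<and>
     (\<exists>t. is_subobject_classifier C t)"

definition geometric_universe :: "('o, 'm) precategory \<Rightarrow> bool" where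
  "geometric_universe C \<longleftrightarrow> elementary_topos C \<and> (\<exists>N z s. is_nno C N z s)"

section \<open>Internal propositional logic\<close>

text \<open>A chosen subobject classifier; all notions below are invariant under isomorphism of
  classifiers and of products.\<close>

definition truth :: "('o, 'm) precategory \<Rightarrow> 'm" where
  "truth C = (SOME t. is_subobject_classifier C t)"

definition Omega :: "('o, 'm) precategory \<Rightarrow> 'o" where
  "Omega C = Cod C (truth C)"

definition classifies :: "('o, 'm) precategory \<Rightarrow> 'm \<Rightarrow> 'm \<Rightarrow> bool" where
  "classifies C \<chi> m \<longleftrightarrow> mono_arr C m \<and> (\<exists>b. is_pullback C m b \<chi> (truth C))"

definition conj_op :: "('o, 'm) precategory \<Rightarrow> 'm" where
  "conj_op C = (THE \<chi>. classifies C \<chi> (pairing C (truth C) (truth C)))"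

text \<open>Implication classifies the internal order of \<open>\<Omega>\<close>, the equalizer of conjunction and the first
  projection.\<close>

definition imp_op :: "('o, 'm) precategory \<Rightarrow> 'm" where
  "imp_op C = (THE \<chi>. \<exists>e. is_equalizer C e (conj_op C) (proj1 C (Omega C) (Omega C)) \<and>
     classifies C \<chi> e)"

text \<open>A formula in a context interpreted by \<open>X\<close> is an arrow \<open>X \<rightarrow> \<Omega>\<close>; a sequent holds when the
  subobject classified by its antecedent is contained in the one classified by its succedent.\<close>

definition imp_form :: "('o, 'm) precategory \<Rightarrow> 'm \<Rightarrow> 'm \<Rightarrow> 'm" where
  "imp_form C \<phi> \<psi> = imp_op C \<cdot>\<^bsub>C\<^esub> pairing C \<phi> \<psi>"

definition sequent_holds :: "('o, 'm) precategory \<Rightarrow> 'm \<Rightarrow> 'm \<Rightarrow> bool" where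
  "sequent_holds C \<phi> \<psi> \<longleftrightarrow>
     (\<exists>u v k. classifies C \<phi> u \<and> classifies C \<psi> v \<and> Cod C u = Cod C v \<and>
        k \<in> hom C (Dom C u) (Dom C v) \<and> v \<cdot>\<^bsub>C\<^esub> k = u)"

section \<open>Later modality structures\<close>

record ('o, 'm) later_data =
  later :: "('o, 'm, 'o, 'm) functor_data"
  nxt :: "'o \<Rightarrow> 'm"

definition later_structure :: "('o, 'm) precategory \<Rightarrow> ('o, 'm) later_data \<Rightarrow> bool" where
  "later_structure C M \<longleftrightarrow>
     left_exact C C (later M) \<and> nat_trans C C id_functor (later M) (nxt M)"

definition well_pointed :: "('o, 'm) precategory \<Rightarrow> ('o, 'm) later_data \<Rightarrow> bool" where
  "well_pointed C M \<longleftrightarrow>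
     (\<forall>A\<in>Obj C. on_arr (later M) (nxt M A) = nxt M (on_obj (later M) A))"

definition later_form :: "('o, 'm) precategory \<Rightarrow> ('o, 'm) later_data \<Rightarrow> 'm \<Rightarrow> 'm" where
  "later_form C M \<phi> = (THE \<chi>. \<exists>u v w. classifies C \<phi> u \<and>
     is_pullback C v w (nxt M (Dom C \<phi>)) (on_arr (later M) u) \<and> classifies C \<chi> v)"

text \<open>In the context \<open>\<phi> : \<Omega>\<close> the variable \<open>\<phi>\<close> is interpreted by the identity of \<open>\<Omega>\<close>, and
  \<open>later_form\<close> of that identity is the internal operator on \<open>\<Omega>\<close>.\<close>

definition supports_loeb :: "('o, 'm) precategory \<Rightarrow> ('o, 'm) later_data \<Rightarrow> bool" where
  "supports_loeb C M \<longleftrightarrow>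
     (let \<phi> = Ident C (Omega C) in sequent_holds C (imp_form C (later_form C M \<phi>) \<phi>) \<phi>)"

definition sgdt_model :: "('o, 'm) precategory \<Rightarrow> ('o, 'm) later_data \<Rightarrow> bool" where
  "sgdt_model C M \<longleftrightarrow>
     geometric_universe C \<and> later_structure C M \<and> well_pointed C M \<and> supports_loeb C M"

section \<open>Left exact localizations\<close>

record ('o, 'm, 'p, 'n) morphism_data =
  inverse_image :: "('o, 'm, 'p, 'n) functor_data"
  direct_image :: "('p, 'n, 'o, 'm) functor_data"
  unit_of :: "'o \<Rightarrow> 'm"
  counit_of :: "'p \<Rightarrow> 'n"

definition adjunction ::
  "('o, 'm) precategory \<Rightarrow> ('p, 'n) precategory \<Rightarrow> ('o, 'm, 'p, 'n) functor_data \<Rightarrow>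
   ('p, 'n, 'o, 'm) functor_data \<Rightarrow> ('o \<Rightarrow> 'm) \<Rightarrow> ('p \<Rightarrow> 'n) \<Rightarrow> bool" where
  "adjunction C D F G \<eta> \<epsilon> \<longleftrightarrow>
     is_functor C D F \<and> is_functor D C G \<and>
     nat_trans C C id_functor (G \<circ>\<^sub>F F) \<eta> \<and> nat_trans D D (F \<circ>\<^sub>F G) id_functor \<epsilon> \<and>
     (\<forall>A\<in>Obj C. \<epsilon> (on_obj F A) \<cdot>\<^bsub>D\<^esub> on_arr F (\<eta> A) = Ident D (on_obj F A)) \<and>
     (\<forall>B\<in>Obj D. on_arr G (\<epsilon> B) \<cdot>\<^bsub>C\<^esub> \<eta> (on_obj G B) = Ident C (on_obj G B))"

definition geometric_universe_morphism ::
  "('o, 'm) precategory \<Rightarrow> ('p, 'n) precategory \<Rightarrow> ('o, 'm, 'p, 'n) morphism_data \<Rightarrow> bool" where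
  "geometric_universe_morphism S T L \<longleftrightarrow>
     geometric_universe S \<and> geometric_universe T \<and> left_exact S T (inverse_image L) \<and>
     adjunction S T (inverse_image L) (direct_image L) (unit_of L) (counit_of L)"

definition left_exact_localization ::
  "('o, 'm) precategory \<Rightarrow> ('p, 'n) precategory \<Rightarrow> ('o, 'm, 'p, 'n) morphism_data \<Rightarrow> bool" where
  "left_exact_localization S T L \<longleftrightarrow>
     geometric_universe_morphism S T L \<and> fully_faithful T S (direct_image L)"

definition localized_later ::
  "('p, 'n) precategory \<Rightarrow> ('o, 'm, 'p, 'n) morphism_data \<Rightarrow> ('o, 'm) later_data \<Rightarrow>
   ('p, 'n) later_data" where
  "localized_later T L M =
     \<lparr>later = inverse_image L \<circ>\<^sub>F later M \<circ>\<^sub>F direct_image L,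
      nxt = (\<lambda>A. on_arr (inverse_image L) (nxt M (on_obj (direct_image L) A))
                   \<cdot>\<^bsub>T\<^esub> inverse_arr T (counit_of L A))\<rparr>"

end

theory Submission
  imports Defs
begin

text \<open>
  The Loeb sequent lives in the internal logic, which the direct image functor need not preserve, so
  it is first replaced by a statement about subobjects (\<open>supports_loeb_iff_external\<close>).  Call a
  subobject \<open>u : U \<rightarrow> X\<close> later-closed if the pullback of \<open>\<triangleright>u\<close> along \<open>next\<close> is contained in \<open>u\<close>.  Loeb
  induction holds if and only if every later-closed subobject is the whole of \<open>X\<close>.  For one direction,
  the Loeb sequent evaluated at the classifying arrow of a later-closed \<open>u\<close> says exactly that \<open>u\<close> is
  everything, since \<open>\<triangleright>\<close> preserves the pullback square that defines this arrow.  For the other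
  direction, the Kripke--Joyal reading of the sequent says: if \<open>\<triangleright>a\<close> entails \<open>a\<close> at every further
  stage, then \<open>a\<close> is true; and the hypothesis here makes the subobject classified by \<open>a\<close>
  later-closed.

  Containment of subobjects is expressed throughout by factorization of generalized elements: \<open>a\<close>
  factors through \<open>u\<close> if it is an element of \<open>u\<close>.  In this form the external condition passes from
  \<open>S\<close> to \<open>T\<close> by transposition alone (\<open>localized_external_loeb\<close>).  Write \<open>F\<close> for the inverse image and
  \<open>G\<close> for the direct image.  If \<open>u\<close> is a later-closed subobject in \<open>T\<close>, then \<open>G u\<close> is later-closed
  in \<open>S\<close>: let \<open>b : Y \<rightarrow> G X\<close> be such that \<open>next \<cdot> b\<close> factors through \<open>\<triangleright>(G u)\<close>; applying \<open>F\<close> shows that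
  the transpose of \<open>b\<close>, followed by the localized \<open>next\<close>, factors through the localized \<open>\<triangleright>u\<close>; hence
  the transpose of \<open>b\<close> factors through \<open>u\<close>, and transposing back, \<open>b\<close> factors through \<open>G u\<close>.  So
  \<open>G u\<close> has a section, and because \<open>G\<close> is fully faithful, so does \<open>u\<close>.

  The localized functor \<open>F \<triangleright> G\<close> is left exact because the right adjoint \<open>G\<close> preserves all limits
  (\<open>right_adjoint_left_exact\<close>).  Well-pointedness follows from the naturality of \<open>next\<close> along the
  unit, because \<open>G\<close> turns the inverse of the counit into the unit.
\<close>

section \<open>Factorization and pullbacks\<close>

definition factors_through :: "('o, 'm) precategory \<Rightarrow> 'm \<Rightarrow> 'm \<Rightarrow> bool" where
  "factors_through C a m \<longleftrightarrow> (\<exists>k\<in>hom C (Dom C a) (Dom C m). m \<cdot>\<^bsub>C\<^esub> k = a)"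

lemma homD:
  assumes "f \<in> hom C A B"
  shows "f \<in> Arr C" "Dom C f = A" "Cod C f = B"
  using assms by (auto simp: hom_def)

lemma hom_DomCod: "f \<in> Arr C \<Longrightarrow> f \<in> hom C (Dom C f) (Cod C f)"
  by (simp add: hom_def)

lemma factors_throughI:
  assumes "k \<in> hom C X U" "m \<in> hom C U A" "a \<in> hom C X A" "m \<cdot>\<^bsub>C\<^esub> k = a"
  shows "factors_through C a m"
  using assms homD unfolding factors_through_def by metis

lemma factors_throughE:
  assumes "factors_through C a m" "a \<in> hom C X A" "m \<in> hom C U B"
  obtains k where "k \<in> hom C X U" "m \<cdot>\<^bsub>C\<^esub> k = a"
  using assms homD unfolding factors_through_def by metis

context category
begin

lemma hom_obj:
  assumes "f \<in> hom C A B"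
  shows "A \<in> Obj C" "B \<in> Obj C"
  using assms dom_obj cod_obj unfolding hom_def by auto

lemma factors_comp:
  assumes "factors_through C a m" "a \<in> hom C X A" "m \<in> hom C U A" "b \<in> hom C Y X"
  shows "factors_through C (a \<cdot> b) m"
proof -
  obtain k where k: "k \<in> hom C X U" "m \<cdot> k = a"
    using factors_throughE[OF assms(1-3)] by metis
  show ?thesis
  proof (rule factors_throughI)
    show "k \<cdot> b \<in> hom C Y U" "a \<cdot> b \<in> hom C Y A"
      using assms k comp_hom by metis+
    show "m \<cdot> (k \<cdot> b) = a \<cdot> b"
      using comp_assoc[OF assms(4) k(1) assms(3)] k by simp
  qed (fact assms)
qed

lemma factors_trans:
  assumes "factors_through C a m" "factors_through C m n"
    "a \<in> hom C X A" "m \<in> hom C U A" "n \<in> hom C V A"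
  shows "factors_through C a n"
proof -
  obtain k where "k \<in> hom C X U" "m \<cdot> k = a"
    using factors_throughE[OF assms(1,3,4)] by metis
  then show ?thesis
    using factors_comp[OF assms(2,4,5)] by metis
qed

lemma factors_self:
  assumes "m \<in> hom C U A"
  shows "factors_through C m m"
  using assms factors_throughI ident_hom comp_ident hom_obj by metis

lemma mono_arrD:
  assumes "mono_arr C m" "m \<in> hom C U A" "f \<in> hom C X U" "g \<in> hom C X U" "m \<cdot> f = m \<cdot> g"
  shows "f = g"
  using assms hom_obj homD unfolding mono_arr_def by metis

lemma mono_arrI:
  assumes "m \<in> hom C U A"
    and "\<And>X f g. \<lbrakk>f \<in> hom C X U; g \<in> hom C X U; m \<cdot> f = m \<cdot> g\<rbrakk> \<Longrightarrow> f = g"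
  shows "mono_arr C m"
  using assms homD unfolding mono_arr_def by metis

lemma pullbackE:
  assumes "is_pullback C p q f g"
  obtains P A B Z where "p \<in> hom C P A" "q \<in> hom C P B" "f \<in> hom C A Z" "g \<in> hom C B Z"
    "f \<cdot> p = g \<cdot> q"
  using assms unfolding is_pullback_def by (elim exE conjE)

lemma pullback_universal:
  assumes pb: "is_pullback C p q f g" and p: "p \<in> hom C P A" and q: "q \<in> hom C P B"
    and a: "a \<in> hom C X A" and b: "b \<in> hom C X B" and eq: "f \<cdot> a = g \<cdot> b"
  shows "\<exists>!h. h \<in> hom C X P \<and> p \<cdot> h = a \<and> q \<cdot> h = b"
proof -
  obtain P' A' B' where h: "p \<in> hom C P' A'" "q \<in> hom C P' B'"
    and u: "\<forall>X\<in>Obj C. \<forall>a\<in>hom C X A'. \<forall>b\<in>hom C X B'. f \<cdot> a = g \<cdot> b \<longrightarrow>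
      (\<exists>!h. h \<in> hom C X P' \<and> p \<cdot> h = a \<and> q \<cdot> h = b)"
    using pb unfolding is_pullback_def by (elim exE conjE)
  have "P' = P" "A' = A" "B' = B"
    using homD[OF h(1)] homD[OF h(2)] homD[OF p] homD[OF q] by simp_all
  then show ?thesis
    using u a b eq hom_obj(1)[OF a] by simp
qed

lemma pullback_lift:
  assumes "is_pullback C p q f g" "p \<in> hom C P A" "q \<in> hom C P B"
    "a \<in> hom C X A" "b \<in> hom C X B" "f \<cdot> a = g \<cdot> b"
  obtains h where "h \<in> hom C X P" "p \<cdot> h = a" "q \<cdot> h = b"
  using pullback_universal[OF assms] by (elim ex1E conjE)

lemma pullback_joint_mono:
  assumes "is_pullback C p q f g" "p \<in> hom C P A" "q \<in> hom C P B"
    "x \<in> hom C X P" "y \<in> hom C X P" "p \<cdot> x = p \<cdot> y" "q \<cdot> x = q \<cdot> y"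
  shows "x = y"
proof -
  obtain Z where fg: "f \<in> hom C A Z" "g \<in> hom C B Z" "f \<cdot> p = g \<cdot> q"
    using pullbackE[OF assms(1)] homD[OF assms(2)] homD[OF assms(3)] homD by metis
  have "f \<cdot> (p \<cdot> x) = g \<cdot> (q \<cdot> x)"
    using comp_assoc[OF assms(4,2) fg(1)] comp_assoc[OF assms(4,3) fg(2)] fg(3) by simp
  then show ?thesis
    using pullback_universal[OF assms(1-3) comp_hom[OF assms(4,2)] comp_hom[OF assms(4,3)]]
      assms(4-7) by auto
qed

lemma pullbackI:
  assumes "p \<in> hom C P A" "q \<in> hom C P B" "f \<in> hom C A Z" "g \<in> hom C B Z" "f \<cdot> p = g \<cdot> q"
    "\<And>X a b. \<lbrakk>a \<in> hom C X A; b \<in> hom C X B; f \<cdot> a = g \<cdot> b\<rbrakk> \<Longrightarrow>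
       \<exists>!h. h \<in> hom C X P \<and> p \<cdot> h = a \<and> q \<cdot> h = b"
  shows "is_pullback C p q f g"
  unfolding is_pullback_def
  by (intro exI[of _ P] exI[of _ A] exI[of _ B] exI[of _ Z] conjI ballI impI assms)

text \<open>The generalized elements of a pulled back subobject are those that land in the original one.\<close>

lemma factors_pullback_iff:
  assumes pb: "is_pullback C p q f g" and a: "a \<in> hom C X (Cod C p)"
  shows "factors_through C a p \<longleftrightarrow> factors_through C (f \<cdot> a) g"
proof -
  obtain P A B Z where h: "p \<in> hom C P A" "q \<in> hom C P B" "f \<in> hom C A Z" "g \<in> hom C B Z"
    and sq: "f \<cdot> p = g \<cdot> q"
    using pullbackE[OF pb] .
  have a: "a \<in> hom C X A"
    using a homD(3)[OF h(1)] by simp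
  have fa: "f \<cdot> a \<in> hom C X Z"
    by (rule comp_hom[OF a h(3)])
  show ?thesis
  proof
    assume "factors_through C a p"
    then obtain k where k: "k \<in> hom C X P" "p \<cdot> k = a"
      by (rule factors_throughE[OF _ a h(1)])
    have "g \<cdot> (q \<cdot> k) = f \<cdot> a"
      using comp_assoc[OF k(1) h(1,3)] comp_assoc[OF k(1) h(2,4)] sq k(2) by simp
    then show "factors_through C (f \<cdot> a) g"
      by (rule factors_throughI[OF comp_hom[OF k(1) h(2)] h(4) fa])
  next
    assume "factors_through C (f \<cdot> a) g"
    then obtain b where b: "b \<in> hom C X B" "g \<cdot> b = f \<cdot> a"
      by (rule factors_throughE[OF _ fa h(4)])
    obtain k where "k \<in> hom C X P" "p \<cdot> k = a"
      using pullback_lift[OF pb h(1,2) a b(1) b(2)[symmetric]] .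
    then show "factors_through C a p"
      using factors_throughI[OF _ h(1) a] by metis
  qed
qed

lemma mono_pullback:
  assumes pb: "is_pullback C p q f g" and g: "mono_arr C g"
  shows "mono_arr C p"
proof -
  obtain P A B Z where h: "p \<in> hom C P A" "q \<in> hom C P B" "f \<in> hom C A Z" "g \<in> hom C B Z"
    and sq: "f \<cdot> p = g \<cdot> q"
    using pullbackE[OF pb] .
  show ?thesis
  proof (rule mono_arrI[OF h(1)])
    fix X x y
    assume x: "x \<in> hom C X P" and y: "y \<in> hom C X P" and eq: "p \<cdot> x = p \<cdot> y"
    have "g \<cdot> (q \<cdot> x) = g \<cdot> (q \<cdot> y)"
      using comp_assoc[OF x h(1,3)] comp_assoc[OF x h(2,4)] comp_assoc[OF y h(1,3)]
        comp_assoc[OF y h(2,4)] sq eq by simp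
    then have "q \<cdot> x = q \<cdot> y"
      by (rule mono_arrD[OF g h(4) comp_hom[OF x h(2)] comp_hom[OF y h(2)]])
    then show "x = y"
      by (rule pullback_joint_mono[OF pb h(1,2) x y eq])
  qed
qed

text \<open>Expressing monomorphisms by a finite limit makes them visible to left exact functors.\<close>

lemma mono_iff_kernel_pair:
  assumes m: "m \<in> hom C U A"
  shows "mono_arr C m \<longleftrightarrow> is_pullback C (Ident C U) (Ident C U) m m"
proof
  have i: "Ident C U \<in> hom C U U"
    using hom_obj(1)[OF m] by (rule ident_hom)
  show "is_pullback C (Ident C U) (Ident C U) m m" if mono: "mono_arr C m"
  proof (rule pullbackI[OF i i m m refl])
    fix X a b
    assume a: "a \<in> hom C X U" and b: "b \<in> hom C X U" and "m \<cdot> a = m \<cdot> b"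
    then have "a = b"
      by (rule mono_arrD[OF mono m])
    then show "\<exists>!h. h \<in> hom C X U \<and> Ident C U \<cdot> h = a \<and> Ident C U \<cdot> h = b"
      using a ident_comp by auto
  qed
  show "mono_arr C m" if pb: "is_pullback C (Ident C U) (Ident C U) m m"
  proof (rule mono_arrI[OF m])
    fix X f g
    assume f: "f \<in> hom C X U" and g: "g \<in> hom C X U" and "m \<cdot> f = m \<cdot> g"
    then obtain h where "h \<in> hom C X U" "Ident C U \<cdot> h = f" "Ident C U \<cdot> h = g"
      using pullback_lift[OF pb i i] by metis
    then show "f = g"
      by simp
  qed
qed

end

section \<open>Functors and natural transformations\<close>

lemma functor_obj:
  assumes "is_functor C D F" "A \<in> Obj C"
  shows "on_obj F A \<in> Obj D"
  using assms unfolding is_functor_def by blast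

lemma functor_hom:
  assumes "is_functor C D F" "f \<in> hom C A B"
  shows "on_arr F f \<in> hom D (on_obj F A) (on_obj F B)"
  using assms unfolding is_functor_def by blast

lemma functor_comp_arr:
  assumes "is_functor C D F" "f \<in> hom C A B" "g \<in> hom C B E"
  shows "on_arr F (g \<cdot>\<^bsub>C\<^esub> f) = on_arr F g \<cdot>\<^bsub>D\<^esub> on_arr F f"
  using assms unfolding is_functor_def by blast

lemma functor_ident:
  assumes "is_functor C D F" "A \<in> Obj C"
  shows "on_arr F (Ident C A) = Ident D (on_obj F A)"
  using assms unfolding is_functor_def by blast

lemma functor_comp:
  assumes F: "is_functor C D F" and G: "is_functor D E G"
  shows "is_functor C E (G \<circ>\<^sub>F F)"
  unfolding is_functor_def comp_functor_def functor_data.simps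
proof (intro conjI allI ballI)
  fix A
  assume A: "A \<in> Obj C"
  show "on_obj G (on_obj F A) \<in> Obj E"
    by (rule functor_obj[OF G functor_obj[OF F A]])
  show "on_arr G (on_arr F (Ident C A)) = Ident E (on_obj G (on_obj F A))"
    by (simp add: functor_ident[OF F A] functor_ident[OF G functor_obj[OF F A]])
next
  fix A B f
  assume "f \<in> hom C A B"
  then show "on_arr G (on_arr F f) \<in> hom E (on_obj G (on_obj F A)) (on_obj G (on_obj F B))"
    by (intro functor_hom[OF G] functor_hom[OF F])
next
  fix A B X f g
  assume f: "f \<in> hom C A B" and g: "g \<in> hom C B X"
  show "on_arr G (on_arr F (g \<cdot>\<^bsub>C\<^esub> f)) =
      on_arr G (on_arr F g) \<cdot>\<^bsub>E\<^esub> on_arr G (on_arr F f)"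
    by (simp add: functor_comp_arr[OF F f g]
      functor_comp_arr[OF G functor_hom[OF F f] functor_hom[OF F g]])
qed

lemma functor_factors:
  assumes F: "is_functor C D F" and am: "factors_through C a m"
    and a: "a \<in> hom C X A" and m: "m \<in> hom C U A"
  shows "factors_through D (on_arr F a) (on_arr F m)"
proof -
  obtain k where k: "k \<in> hom C X U" "m \<cdot>\<^bsub>C\<^esub> k = a"
    using factors_throughE[OF am a m] .
  show ?thesis
    by (rule factors_throughI[OF functor_hom[OF F k(1)] functor_hom[OF F m] functor_hom[OF F a]])
      (simp add: functor_comp_arr[OF F k(1) m, symmetric] k(2))
qed

lemma nat_trans_hom:
  assumes "nat_trans C D F G \<alpha>" "A \<in> Obj C"
  shows "\<alpha> A \<in> hom D (on_obj F A) (on_obj G A)"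
  using assms unfolding nat_trans_def by simp

lemma nat_trans_natural:
  assumes "nat_trans C D F G \<alpha>" "f \<in> hom C A B"
  shows "\<alpha> B \<cdot>\<^bsub>D\<^esub> on_arr F f = on_arr G f \<cdot>\<^bsub>D\<^esub> \<alpha> A"
  using assms unfolding nat_trans_def by simp

lemma left_exact_comp:
  assumes F: "left_exact C D F" and G: "left_exact D E G"
  shows "left_exact C E (G \<circ>\<^sub>F F)"
proof -
  have Ff: "is_functor C D F" and Gf: "is_functor D E G"
    using F G by (simp_all add: left_exact_def)
  show ?thesis
    unfolding left_exact_def
  proof (intro conjI allI impI functor_comp[OF Ff Gf], elim conjE)
    fix J K A \<pi>
    assume J: "finite_shape J" and K: "is_functor J C K" and lim: "limit_cone C J K A \<pi>"
    have "limit_cone D J (F \<circ>\<^sub>F K) (on_obj F A) (\<lambda>i. on_arr F (\<pi> i))"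
      using F J K lim unfolding left_exact_def by blast
    then have "limit_cone E J (G \<circ>\<^sub>F (F \<circ>\<^sub>F K)) (on_obj G (on_obj F A)) (\<lambda>i. on_arr G (on_arr F (\<pi> i)))"
      using G J functor_comp[OF K Ff] unfolding left_exact_def by blast
    then show "limit_cone E J ((G \<circ>\<^sub>F F) \<circ>\<^sub>F K) (on_obj (G \<circ>\<^sub>F F) A) (\<lambda>i. on_arr (G \<circ>\<^sub>F F) (\<pi> i))"
      by (simp add: comp_functor_def)
  qed
qed

section \<open>Pullbacks as finite limits\<close>

text \<open>The objects 0, 1 and 2 are their own identities; 3 and 4 are the legs from 0 and 1 to 2.
  A composite is therefore whichever factor is not the identity.\<close>

definition cospan :: "(nat, nat) precategory" where
  "cospan = \<lparr>Obj = {0, 1, 2}, Arr = {0, 1, 2, 3, 4},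
     Dom = (\<lambda>k. if k = 3 then 0 else if k = 4 then 1 else k),
     Cod = (\<lambda>k. if k = 3 \<or> k = 4 then 2 else k),
     Ident = (\<lambda>k. k), Comp = (\<lambda>g f. if f = 3 \<or> f = 4 then f else g)\<rparr>"

lemma cospan_hom:
  "f \<in> hom cospan i k \<longleftrightarrow>
     i = k \<and> f = i \<and> i \<in> {0, 1, 2} \<or> f = 3 \<and> i = 0 \<and> k = 2 \<or> f = 4 \<and> i = 1 \<and> k = 2"
  unfolding hom_def cospan_def by auto

lemma cospan_Obj: "Obj cospan = {0, 1, 2}"
  and cospan_Ident: "Ident cospan i = i"
  and cospan_Comp: "g \<cdot>\<^bsub>cospan\<^esub> f = (if f = 3 \<or> f = 4 then f else g)"
  by (simp_all add: cospan_def)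

lemma finite_shape_cospan: "finite_shape cospan"
proof -
  have "category cospan"
    by unfold_locales (auto simp: cospan_hom, auto simp: cospan_def)
  then show ?thesis
    by (simp add: finite_shape_def cospan_def)
qed

definition cospan_diagram ::
  "('o, 'm) precategory \<Rightarrow> 'm \<Rightarrow> 'm \<Rightarrow> (nat, nat, 'o, 'm) functor_data" where
  "cospan_diagram C f g = (let ob = (\<lambda>i. if i = 0 then Dom C f else if i = 1 then Dom C g else Cod C f)
     in \<lparr>on_obj = ob, on_arr = (\<lambda>k. if k = 3 then f else if k = 4 then g else Ident C (ob k))\<rparr>)"

context category
begin

lemma cospan_diagram_values:
  assumes "f \<in> hom C A Z" "g \<in> hom C B Z"
  shows "on_obj (cospan_diagram C f g) 0 = A" "on_obj (cospan_diagram C f g) 1 = B"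
    "on_obj (cospan_diagram C f g) 2 = Z"
    "on_arr (cospan_diagram C f g) 0 = Ident C A" "on_arr (cospan_diagram C f g) 1 = Ident C B"
    "on_arr (cospan_diagram C f g) 2 = Ident C Z"
    "on_arr (cospan_diagram C f g) 3 = f" "on_arr (cospan_diagram C f g) 4 = g"
  by (simp_all add: cospan_diagram_def Let_def homD[OF assms(1)] homD[OF assms(2)])

lemma cospan_diagram_functor:
  assumes f: "f \<in> hom C A Z" and g: "g \<in> hom C B Z"
  shows "is_functor cospan C (cospan_diagram C f g)"
proof -
  note v = cospan_diagram_values[OF f g]
  note ob = hom_obj[OF f] hom_obj[OF g]
  note i = ident_hom[OF ob(1)] ident_hom[OF ob(2)] ident_hom[OF ob(3)]
  note c = comp_ident[OF f] comp_ident[OF g] ident_comp[OF f] ident_comp[OF g]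
    comp_ident[OF i(1)] comp_ident[OF i(2)] comp_ident[OF i(3)]
  show ?thesis
    unfolding is_functor_def
  proof (intro conjI allI ballI)
    fix i
    assume "i \<in> Obj cospan"
    then have "i = 0 \<or> i = 1 \<or> i = 2"
      by (simp add: cospan_def)
    then show "on_obj (cospan_diagram C f g) i \<in> Obj C"
      "on_arr (cospan_diagram C f g) (Ident cospan i) = Ident C (on_obj (cospan_diagram C f g) i)"
      using v ob by (auto simp: cospan_Ident)
  next
    fix i j u
    assume "u \<in> hom cospan i j"
    then show "on_arr (cospan_diagram C f g) u
        \<in> hom C (on_obj (cospan_diagram C f g) i) (on_obj (cospan_diagram C f g) j)"
      unfolding cospan_hom using v i f g by auto
  next
    fix i j k u w
    assume "u \<in> hom cospan i j" "w \<in> hom cospan j k"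
    then show "on_arr (cospan_diagram C f g) (w \<cdot>\<^bsub>cospan\<^esub> u) =
        on_arr (cospan_diagram C f g) w \<cdot> on_arr (cospan_diagram C f g) u"
      unfolding cospan_hom using v c by (auto simp: cospan_Comp)
  qed
qed

lemma cone_cospan_iff:
  assumes K: "is_functor cospan C K"
  shows "cone C cospan K X \<rho> \<longleftrightarrow>
    \<rho> 0 \<in> hom C X (on_obj K 0) \<and> \<rho> 1 \<in> hom C X (on_obj K 1) \<and>
    on_arr K 3 \<cdot> \<rho> 0 = \<rho> 2 \<and> on_arr K 4 \<cdot> \<rho> 1 = \<rho> 2"
  (is "_ \<longleftrightarrow> ?R")
proof
  assume c: "cone C cospan K X \<rho>"
  have "3 \<in> hom cospan 0 2" "4 \<in> hom cospan 1 2" "0 \<in> Obj cospan" "1 \<in> Obj cospan"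
    by (simp_all add: cospan_hom cospan_Obj)
  then show ?R
    using c unfolding cone_def by blast
next
  assume R: ?R
  have k3: "on_arr K 3 \<in> hom C (on_obj K 0) (on_obj K 2)"
    by (rule functor_hom[OF K]) (simp add: cospan_hom)
  have Ki: "on_arr K i = Ident C (on_obj K i)" if "i \<in> {0,1,2}" for i
    using functor_ident[OF K, of i] that by (simp add: cospan_Obj cospan_Ident)
  have r2: "\<rho> 2 \<in> hom C X (on_obj K 2)"
    using R comp_hom[OF _ k3] by metis
  have r: "\<rho> i \<in> hom C X (on_obj K i)" if "i \<in> {0,1,2}" for i
    using that r2 R by auto
  show "cone C cospan K X \<rho>"
    unfolding cone_def
  proof (intro conjI ballI allI)
    show "X \<in> Obj C"
      by (rule hom_obj(1)[OF r2])
    show "\<rho> i \<in> hom C X (on_obj K i)" if "i \<in> Obj cospan" for i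
      using r that by (simp add: cospan_Obj)
    fix i k u
    assume "u \<in> hom cospan i k"
    then consider "i = k" "u = i" "i \<in> {0,1,2}" | "u = 3" "i = 0" "k = 2" | "u = 4" "i = 1" "k = 2"
      unfolding cospan_hom by blast
    then show "on_arr K u \<cdot> \<rho> i = \<rho> k"
    proof cases
      case 1
      then show ?thesis
        using Ki[OF 1(3)] ident_comp[OF r[OF 1(3)]] by simp
    qed (use R in simp_all)
  qed
qed

text \<open>A cone over a cospan is determined by its components at the two feet, so the component at 2 may
  be eliminated.  The functor \<open>K\<close> is arbitrary because the image of a cospan diagram under a functor is
  a functor on \<open>cospan\<close> which need not itself have the form \<open>cospan_diagram\<close>.\<close>

lemma limit_cone_cospan_iff:
  assumes K: "is_functor cospan C K"
    and r2: "\<pi> 2 = on_arr K 3 \<cdot> \<pi> 0"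
  shows "limit_cone C cospan K P \<pi> \<longleftrightarrow>
    \<pi> 0 \<in> hom C P (on_obj K 0) \<and> \<pi> 1 \<in> hom C P (on_obj K 1) \<and>
    is_pullback C (\<pi> 0) (\<pi> 1) (on_arr K 3) (on_arr K 4)"
proof -
  have k: "on_arr K 3 \<in> hom C (on_obj K 0) (on_obj K 2)" "on_arr K 4 \<in> hom C (on_obj K 1) (on_obj K 2)"
    using K unfolding is_functor_def by (simp_all add: cospan_hom)
  show ?thesis
  proof (intro iffI conjI)
    assume lim: "limit_cone C cospan K P \<pi>"
    then have c: "cone C cospan K P \<pi>"
      by (simp add: limit_cone_def)
    show p0: "\<pi> 0 \<in> hom C P (on_obj K 0)" and p1: "\<pi> 1 \<in> hom C P (on_obj K 1)"
      using c cone_cospan_iff[OF K] by auto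
    have eq: "on_arr K 3 \<cdot> \<pi> 0 = on_arr K 4 \<cdot> \<pi> 1"
      using c cone_cospan_iff[OF K] by auto
    show "is_pullback C (\<pi> 0) (\<pi> 1) (on_arr K 3) (on_arr K 4)"
    proof (rule pullbackI[OF p0 p1 k eq])
      fix X a b
      assume a: "a \<in> hom C X (on_obj K 0)" and b: "b \<in> hom C X (on_obj K 1)"
        and ab: "on_arr K 3 \<cdot> a = on_arr K 4 \<cdot> b"
      let ?\<rho> = "\<lambda>i::nat. if i = 0 then a else if i = 1 then b else on_arr K 3 \<cdot> a"
      have "cone C cospan K X ?\<rho>"
        using a b ab by (simp add: cone_cospan_iff[OF K])
      then have "\<exists>!h. h \<in> hom C X P \<and> (\<forall>i\<in>Obj cospan. \<pi> i \<cdot> h = ?\<rho> i)"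
        using lim unfolding limit_cone_def by blast
      moreover have "(h \<in> hom C X P \<and> (\<forall>i\<in>Obj cospan. \<pi> i \<cdot> h = ?\<rho> i)) \<longleftrightarrow>
          (h \<in> hom C X P \<and> \<pi> 0 \<cdot> h = a \<and> \<pi> 1 \<cdot> h = b)" for h
        using comp_assoc[OF _ p0 k(1)] r2 by (auto simp: cospan_def)
      ultimately show "\<exists>!h. h \<in> hom C X P \<and> \<pi> 0 \<cdot> h = a \<and> \<pi> 1 \<cdot> h = b"
        by simp
    qed
  next
    assume *: "\<pi> 0 \<in> hom C P (on_obj K 0) \<and> \<pi> 1 \<in> hom C P (on_obj K 1) \<and>
      is_pullback C (\<pi> 0) (\<pi> 1) (on_arr K 3) (on_arr K 4)"
    then have p0: "\<pi> 0 \<in> hom C P (on_obj K 0)" and p1: "\<pi> 1 \<in> hom C P (on_obj K 1)"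
      by auto
    have eq: "on_arr K 3 \<cdot> \<pi> 0 = on_arr K 4 \<cdot> \<pi> 1"
      using * unfolding is_pullback_def by auto
    have u: "\<exists>!h. h \<in> hom C X P \<and> \<pi> 0 \<cdot> h = a \<and> \<pi> 1 \<cdot> h = b"
      if "a \<in> hom C X (on_obj K 0)" "b \<in> hom C X (on_obj K 1)" "on_arr K 3 \<cdot> a = on_arr K 4 \<cdot> b"
      for X a b
      using pullback_universal[OF _ p0 p1 that] * by blast
    show "limit_cone C cospan K P \<pi>"
      unfolding limit_cone_def
    proof (intro conjI allI impI)
      show "cone C cospan K P \<pi>"
        using p0 p1 eq r2 by (simp add: cone_cospan_iff[OF K])
      fix X \<rho>
      assume "cone C cospan K X \<rho>"
      then have r: "\<rho> 0 \<in> hom C X (on_obj K 0)" "\<rho> 1 \<in> hom C X (on_obj K 1)"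
        "on_arr K 3 \<cdot> \<rho> 0 = \<rho> 2" "on_arr K 4 \<cdot> \<rho> 1 = \<rho> 2"
        by (simp_all add: cone_cospan_iff[OF K])
      have "(h \<in> hom C X P \<and> (\<forall>i\<in>Obj cospan. \<pi> i \<cdot> h = \<rho> i)) \<longleftrightarrow>
          (h \<in> hom C X P \<and> \<pi> 0 \<cdot> h = \<rho> 0 \<and> \<pi> 1 \<cdot> h = \<rho> 1)" for h
        using comp_assoc[OF _ p0 k(1)] r2 r by (auto simp: cospan_def)
      then show "\<exists>!h. h \<in> hom C X P \<and> (\<forall>i\<in>Obj cospan. \<pi> i \<cdot> h = \<rho> i)"
        using u[OF r(1,2)] r by simp
    qed
  qed
qed

lemma pullback_exists:
  assumes "has_finite_limits C" "f \<in> hom C A Z" "g \<in> hom C B Z"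
  shows "\<exists>P p q. p \<in> hom C P A \<and> q \<in> hom C P B \<and> is_pullback C p q f g"
proof -
  let ?K = "cospan_diagram C f g"
  have K: "is_functor cospan C ?K"
    using assms cospan_diagram_functor by blast
  have v: "on_obj ?K 0 = A" "on_obj ?K 1 = B" "on_arr ?K 3 = f" "on_arr ?K 4 = g"
    using homD[OF assms(2)] homD[OF assms(3)] by (simp_all add: cospan_diagram_def Let_def)
  obtain P \<pi> where lim: "limit_cone C cospan ?K P \<pi>"
    using assms(1) K finite_shape_cospan unfolding has_finite_limits_def by blast
  then have "\<pi> 2 = on_arr ?K 3 \<cdot> \<pi> 0"
    using cone_cospan_iff[OF K, of P \<pi>] unfolding limit_cone_def by simp
  then show ?thesis
    using limit_cone_cospan_iff[OF K, of \<pi> P] lim v by auto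
qed

end

lemma left_exact_pullback:
  assumes C: "category C" and D: "category D" and F: "left_exact C D F"
    and pb: "is_pullback C p q f g"
  shows "is_pullback D (on_arr F p) (on_arr F q) (on_arr F f) (on_arr F g)"
proof -
  interpret C: category C by (fact C)
  interpret D: category D by (fact D)
  obtain P A B Z where h: "p \<in> hom C P A" "q \<in> hom C P B" "f \<in> hom C A Z" "g \<in> hom C B Z"
    using C.pullbackE[OF pb] by metis
  have Ff: "is_functor C D F"
    using F by (simp add: left_exact_def)
  let ?K = "cospan_diagram C f g"
  let ?\<pi> = "\<lambda>i::nat. if i = 0 then p else if i = 1 then q else f \<cdot>\<^bsub>C\<^esub> p"
  have K: "is_functor cospan C ?K"
    using h C.cospan_diagram_functor by blast
  have v: "on_obj ?K 0 = A" "on_obj ?K 1 = B" "on_arr ?K 3 = f" "on_arr ?K 4 = g"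
    using homD[OF h(3)] homD[OF h(4)] by (simp_all add: cospan_diagram_def Let_def)
  have "limit_cone C cospan ?K P ?\<pi>"
    using C.limit_cone_cospan_iff[OF K, of ?\<pi> P] pb h v by auto
  then have "limit_cone D cospan (F \<circ>\<^sub>F ?K) (on_obj F P) (\<lambda>i. on_arr F (?\<pi> i))"
    using F K finite_shape_cospan unfolding left_exact_def by blast
  then show ?thesis
    using D.limit_cone_cospan_iff[OF functor_comp[OF K Ff], of "\<lambda>i. on_arr F (?\<pi> i)" "on_obj F P"] v
      functor_comp_arr[OF Ff h(1,3)]
    by (simp add: comp_functor_def)
qed

lemma left_exact_mono:
  assumes C: "category C" and D: "category D" and F: "left_exact C D F"
    and m: "mono_arr C m"
  shows "mono_arr D (on_arr F m)"
proof -
  interpret C: category C by (fact C)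
  interpret D: category D by (fact D)
  have Ff: "is_functor C D F"
    using F by (simp add: left_exact_def)
  have h: "m \<in> hom C (Dom C m) (Cod C m)"
    using m unfolding mono_arr_def by (simp add: hom_DomCod)
  have "is_pullback C (Ident C (Dom C m)) (Ident C (Dom C m)) m m"
    using m C.mono_iff_kernel_pair[OF h] by simp
  from left_exact_pullback[OF C D F this] show ?thesis
    unfolding functor_ident[OF Ff C.hom_obj(1)[OF h]]
    using D.mono_iff_kernel_pair[OF functor_hom[OF Ff h]] by simp
qed

section \<open>Truth of formulas\<close>

text \<open>The part of the structure of a topos on which the propositional connectives depend.\<close>

locale classifying_category = category C for C :: "('o, 'm) precategory" (structure) +
  assumes finite_limits: "has_finite_limits C"
    and classifier: "\<exists>t. is_subobject_classifier C t"
begin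

abbreviation "holds p \<equiv> factors_through C p (truth C)"

definition one :: 'o where "one = Dom C (truth C)"

lemma truth_classifier: "is_subobject_classifier C (truth C)"
  unfolding truth_def by (rule someI_ex[OF classifier])

lemma truth_hom: "truth C \<in> hom C one (Omega C)"
proof -
  have "truth C \<in> Arr C"
    using truth_classifier unfolding is_subobject_classifier_def by (elim conjE)
  then show ?thesis
    unfolding one_def Omega_def by (rule hom_DomCod)
qed

lemma terminal_one: "terminal C one"
  using truth_classifier unfolding is_subobject_classifier_def one_def by (elim conjE)

lemma to_one_unique:
  assumes "f \<in> hom C X one" "g \<in> hom C X one"
  shows "f = g"
proof -
  have "\<exists>!f. f \<in> hom C X one"
    using terminal_one hom_obj(1)[OF assms(1)] unfolding terminal_def by simp
  then show ?thesis
    using assms by auto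
qed

lemma to_one_exists:
  assumes "X \<in> Obj C"
  obtains f where "f \<in> hom C X one"
proof -
  have "\<exists>!f. f \<in> hom C X one"
    using terminal_one assms unfolding terminal_def by simp
  then show thesis
    using that by auto
qed

lemma mono_from_one:
  assumes "m \<in> hom C one X"
  shows "mono_arr C m"
  by (rule mono_arrI[OF assms]) (rule to_one_unique)

lemma classifies_hom:
  assumes "classifies C \<chi> m"
  shows "m \<in> hom C (Dom C m) (Cod C m)" "\<chi> \<in> hom C (Cod C m) (Omega C)"
proof -
  obtain b where pb: "is_pullback C m b \<chi> (truth C)"
    using assms unfolding classifies_def by blast
  obtain P A B Z where h: "m \<in> hom C P A" "\<chi> \<in> hom C A Z" "truth C \<in> hom C B Z"
    using pullbackE[OF pb] .
  have "Z = Omega C"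
    using homD(3)[OF h(3)] homD(3)[OF truth_hom] by simp
  then show "m \<in> hom C (Dom C m) (Cod C m)" "\<chi> \<in> hom C (Cod C m) (Omega C)"
    using h homD[OF h(1)] by simp_all
qed

lemma holds_iff_factors:
  assumes "classifies C \<chi> m" "a \<in> hom C Y (Cod C m)"
  shows "holds (\<chi> \<cdot> a) \<longleftrightarrow> factors_through C a m"
proof -
  obtain b where "is_pullback C m b \<chi> (truth C)"
    using assms(1) unfolding classifies_def by blast
  then show ?thesis
    using factors_pullback_iff[OF _ assms(2)] by simp
qed

text \<open>To be classified by \<open>\<chi>\<close> is a condition on generalized elements alone: the missing leg of the
  pullback square is the witness that \<open>\<chi>\<close> is true at the generic element, \<open>m\<close> itself.\<close>

lemma classifiesI:
  assumes mono: "mono_arr C m" and m: "m \<in> hom C U X" and \<chi>: "\<chi> \<in> hom C X (Omega C)"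
    and iff: "\<And>Y a. a \<in> hom C Y X \<Longrightarrow> holds (\<chi> \<cdot> a) \<longleftrightarrow> factors_through C a m"
  shows "classifies C \<chi> m"
proof -
  have "holds (\<chi> \<cdot> m)"
    using iff[OF m] factors_self[OF m] by simp
  then obtain b where b: "b \<in> hom C U one" "truth C \<cdot> b = \<chi> \<cdot> m"
    by (rule factors_throughE[OF _ comp_hom[OF m \<chi>] truth_hom])
  have "is_pullback C m b \<chi> (truth C)"
  proof (rule pullbackI[OF m b(1) \<chi> truth_hom b(2)[symmetric]])
    fix Y a c
    assume a: "a \<in> hom C Y X" and c: "c \<in> hom C Y one" and eq: "\<chi> \<cdot> a = truth C \<cdot> c"
    have "holds (\<chi> \<cdot> a)"
      by (rule factors_throughI[OF c truth_hom comp_hom[OF a \<chi>] eq[symmetric]])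
    then have "factors_through C a m"
      using iff[OF a] by simp
    then obtain k where k: "k \<in> hom C Y U" "m \<cdot> k = a"
      by (rule factors_throughE[OF _ a m])
    show "\<exists>!h. h \<in> hom C Y U \<and> m \<cdot> h = a \<and> b \<cdot> h = c"
    proof (rule ex1I[of _ k])
      show "k \<in> hom C Y U \<and> m \<cdot> k = a \<and> b \<cdot> k = c"
        using k to_one_unique[OF comp_hom[OF k(1) b(1)] c] by simp
      show "h = k" if "h \<in> hom C Y U \<and> m \<cdot> h = a \<and> b \<cdot> h = c" for h
        using that k mono_arrD[OF mono m, of h Y k] by simp
    qed
  qed
  then show ?thesis
    using mono unfolding classifies_def by blast
qed

lemma classifies_unique:
  assumes "classifies C \<chi> m" "classifies C \<chi>' m"
  shows "\<chi> = \<chi>'"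
proof -
  have "mono_arr C m"
    using assms(1) by (simp add: classifies_def)
  then have "\<exists>!\<chi>. \<chi> \<in> hom C (Cod C m) (Omega C) \<and> (\<exists>b. is_pullback C m b \<chi> (truth C))"
    using truth_classifier by (simp add: is_subobject_classifier_def Omega_def)
  moreover have "\<exists>b. is_pullback C m b \<chi> (truth C)" "\<exists>b. is_pullback C m b \<chi>' (truth C)"
    using assms by (simp_all add: classifies_def)
  ultimately show ?thesis
    using classifies_hom(2)[OF assms(1)] classifies_hom(2)[OF assms(2)] by auto
qed

lemma classifier_of_mono:
  assumes "mono_arr C m"
  obtains \<chi> where "classifies C \<chi> m"
proof -
  have "\<exists>!\<chi>. \<chi> \<in> hom C (Cod C m) (Omega C) \<and> (\<exists>b. is_pullback C m b \<chi> (truth C))"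
    using truth_classifier assms by (simp add: is_subobject_classifier_def Omega_def)
  then show thesis
    using that assms by (auto simp: classifies_def)
qed

lemma classified_mono:
  assumes "\<chi> \<in> hom C X (Omega C)"
  obtains U m where "m \<in> hom C U X" "classifies C \<chi> m"
proof -
  obtain U m b where m: "m \<in> hom C U X" and pb: "is_pullback C m b \<chi> (truth C)"
    using pullback_exists[OF finite_limits assms truth_hom] by blast
  show thesis
    by (rule that[OF m]) (use pb mono_pullback[OF pb mono_from_one[OF truth_hom]] in
      \<open>auto simp: classifies_def\<close>)
qed

text \<open>Extensionality of formulas: the subobject classified by \<open>p\<close> has the same elements as \<open>q\<close>, so
  it is also classified by \<open>q\<close>, and classifying arrows are unique.\<close>

lemma formula_eqI:
  assumes p: "p \<in> hom C X (Omega C)" and q: "q \<in> hom C X (Omega C)"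
    and iff: "\<And>Y a. a \<in> hom C Y X \<Longrightarrow> holds (p \<cdot> a) \<longleftrightarrow> holds (q \<cdot> a)"
  shows "p = q"
proof -
  obtain U m where m: "m \<in> hom C U X" "classifies C p m"
    using classified_mono[OF p] .
  have "classifies C q m"
    by (rule classifiesI[OF _ m(1) q])
      (use m iff holds_iff_factors[OF m(2)] homD(3)[OF m(1)] in \<open>auto simp: classifies_def\<close>)
  then show ?thesis
    by (rule classifies_unique[OF m(2)])
qed

text \<open>The Kripke--Joyal reading of entailment.\<close>

lemma sequent_iff:
  assumes p: "p \<in> hom C X (Omega C)" and q: "q \<in> hom C X (Omega C)"
  shows "sequent_holds C p q \<longleftrightarrow> (\<forall>Y. \<forall>a\<in>hom C Y X. holds (p \<cdot> a) \<longrightarrow> holds (q \<cdot> a))"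
proof
  assume "sequent_holds C p q"
  then obtain u v k where u: "classifies C p u" and v: "classifies C q v"
    and uv: "Cod C u = Cod C v" and k: "k \<in> hom C (Dom C u) (Dom C v)" "v \<cdot> k = u"
    unfolding sequent_holds_def by blast
  have X: "Cod C u = X" "Cod C v = X"
    using homD(2)[OF p] homD(2)[OF classifies_hom(2)[OF u]] uv by simp_all
  have uh: "u \<in> hom C (Dom C u) X" and vh: "v \<in> hom C (Dom C v) X"
    using classifies_hom(1)[OF u] classifies_hom(1)[OF v] X by simp_all
  show "\<forall>Y. \<forall>a\<in>hom C Y X. holds (p \<cdot> a) \<longrightarrow> holds (q \<cdot> a)"
  proof (intro allI ballI impI)
    fix Y a
    assume a: "a \<in> hom C Y X" and pa: "holds (p \<cdot> a)"
    have "factors_through C a u"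
      using pa holds_iff_factors[OF u] a X by simp
    then have "factors_through C a v"
      by (rule factors_trans[OF _ factors_throughI[OF k(1) vh uh k(2)] a uh vh])
    then show "holds (q \<cdot> a)"
      using holds_iff_factors[OF v] a X by simp
  qed
next
  assume imp: "\<forall>Y. \<forall>a\<in>hom C Y X. holds (p \<cdot> a) \<longrightarrow> holds (q \<cdot> a)"
  obtain U u where u: "u \<in> hom C U X" "classifies C p u"
    using classified_mono[OF p] .
  obtain V v where v: "v \<in> hom C V X" "classifies C q v"
    using classified_mono[OF q] .
  have "factors_through C u v"
    using holds_iff_factors[OF u(2)] holds_iff_factors[OF v(2)] u(1) imp factors_self[OF u(1)]
      homD(3)[OF u(1)] homD(3)[OF v(1)] by metis
  then show "sequent_holds C p q"
    unfolding sequent_holds_def factors_through_def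
    using u v homD[OF u(1)] homD[OF v(1)] by metis
qed

section \<open>Conjunction and implication\<close>

text \<open>Products are pullbacks over the terminal object, and the equalizer of \<open>f\<close> and \<open>g\<close> is the pullback
  of their graphs; hence cospans are the only finite shape for which limits have to be unpacked.\<close>

lemma product_exists:
  assumes "A \<in> Obj C" "B \<in> Obj C"
  shows "\<exists>P p q. is_product C A B P p q"
proof -
  obtain a where a: "a \<in> hom C A one"
    using to_one_exists[OF assms(1)] .
  obtain b where b: "b \<in> hom C B one"
    using to_one_exists[OF assms(2)] .
  obtain P p q where p: "p \<in> hom C P A" and q: "q \<in> hom C P B" and pb: "is_pullback C p q a b"
    using pullback_exists[OF finite_limits a b] by blast
  have "is_product C A B P p q"
    unfolding is_product_def
  proof (intro conjI ballI p q)
    fix X x y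
    assume x: "x \<in> hom C X A" and y: "y \<in> hom C X B"
    show "\<exists>!h. h \<in> hom C X P \<and> p \<cdot> h = x \<and> q \<cdot> h = y"
      by (rule pullback_universal[OF pb p q x y to_one_unique[OF comp_hom[OF x a] comp_hom[OF y b]]])
  qed
  then show ?thesis
    by blast
qed

lemma chosen_product:
  assumes "A \<in> Obj C" "B \<in> Obj C"
  shows "is_product C A B (prod_obj C A B) (proj1 C A B) (proj2 C A B)"
proof -
  have "\<exists>z. case z of (P, p, q) \<Rightarrow> is_product C A B P p q"
    using product_exists[OF assms] by simp
  then have "case prod_cone C A B of (P, p, q) \<Rightarrow> is_product C A B P p q"
    unfolding prod_cone_def by (rule someI_ex)
  then show ?thesis
    by (simp add: prod_obj_def proj1_def proj2_def split_beta)
qed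

lemma proj_hom:
  assumes "A \<in> Obj C" "B \<in> Obj C"
  shows "proj1 C A B \<in> hom C (prod_obj C A B) A" "proj2 C A B \<in> hom C (prod_obj C A B) B"
  using chosen_product[OF assms] unfolding is_product_def by auto

lemma prod_eqI:
  assumes "A \<in> Obj C" "B \<in> Obj C"
    and x: "x \<in> hom C X (prod_obj C A B)" and y: "y \<in> hom C X (prod_obj C A B)"
    and eq: "proj1 C A B \<cdot> x = proj1 C A B \<cdot> y" "proj2 C A B \<cdot> x = proj2 C A B \<cdot> y"
  shows "x = y"
proof -
  note p = proj_hom[OF assms(1,2)]
  have "\<exists>!h. h \<in> hom C X (prod_obj C A B) \<and> proj1 C A B \<cdot> h = proj1 C A B \<cdot> x \<and>
      proj2 C A B \<cdot> h = proj2 C A B \<cdot> x"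
    using chosen_product[OF assms(1,2)] hom_obj(1)[OF x] comp_hom[OF x p(1)] comp_hom[OF x p(2)]
    unfolding is_product_def by simp
  then show ?thesis
    using x y eq by auto
qed

lemma pairing:
  assumes f: "f \<in> hom C X A" and g: "g \<in> hom C X B"
  shows "pairing C f g \<in> hom C X (prod_obj C A B)"
    "proj1 C A B \<cdot> pairing C f g = f" "proj2 C A B \<cdot> pairing C f g = g"
proof -
  have "\<exists>!h. h \<in> hom C X (prod_obj C A B) \<and> proj1 C A B \<cdot> h = f \<and> proj2 C A B \<cdot> h = g"
    using chosen_product[OF hom_obj(2)[OF f] hom_obj(2)[OF g]] hom_obj(1)[OF f] f g
    unfolding is_product_def by simp
  from theI'[OF this]
  have "pairing C f g \<in> hom C X (prod_obj C A B) \<and>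
    proj1 C A B \<cdot> pairing C f g = f \<and> proj2 C A B \<cdot> pairing C f g = g"
    unfolding pairing_def homD[OF f] homD[OF g] .
  then show "pairing C f g \<in> hom C X (prod_obj C A B)"
    "proj1 C A B \<cdot> pairing C f g = f" "proj2 C A B \<cdot> pairing C f g = g"
    by auto
qed

lemma equalizer_exists:
  assumes f: "f \<in> hom C A B" and g: "g \<in> hom C A B"
  shows "\<exists>e. is_equalizer C e f g"
proof -
  note A = hom_obj(1)[OF f] and B = hom_obj(2)[OF f]
  note i = ident_hom[OF A]
  note pf = pairing[OF i f] and pg = pairing[OF i g]
  note pr = proj_hom[OF A B]
  obtain E e e' where e: "e \<in> hom C E A" "e' \<in> hom C E A"
    and pb: "is_pullback C e e' (pairing C (Ident C A) f) (pairing C (Ident C A) g)"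
    using pullback_exists[OF finite_limits pf(1) pg(1)] by blast
  \<comment> \<open>Two elements with equal images in the two graphs have equal first components, so the two legs
    of the pullback of the graphs coincide.\<close>
  have comps: "x = y \<and> f \<cdot> x = g \<cdot> y"
    if x: "x \<in> hom C X A" and y: "y \<in> hom C X A"
      and eq: "pairing C (Ident C A) f \<cdot> x = pairing C (Ident C A) g \<cdot> y" for X x y
  proof
    have "proj1 C A B \<cdot> (pairing C (Ident C A) f \<cdot> x) = x"
      using comp_assoc[OF x pf(1) pr(1)] pf(2) ident_comp[OF x] by simp
    moreover have "proj1 C A B \<cdot> (pairing C (Ident C A) g \<cdot> y) = y"
      using comp_assoc[OF y pg(1) pr(1)] pg(2) ident_comp[OF y] by simp
    ultimately show "x = y"
      using eq by simp
    have "proj2 C A B \<cdot> (pairing C (Ident C A) f \<cdot> x) = f \<cdot> x"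
      using comp_assoc[OF x pf(1) pr(2)] pf(3) by simp
    moreover have "proj2 C A B \<cdot> (pairing C (Ident C A) g \<cdot> y) = g \<cdot> y"
      using comp_assoc[OF y pg(1) pr(2)] pg(3) by simp
    ultimately show "f \<cdot> x = g \<cdot> y"
      using eq by simp
  qed
  have pairs: "pairing C (Ident C A) f \<cdot> x = pairing C (Ident C A) g \<cdot> x"
    if x: "x \<in> hom C X A" and eq: "f \<cdot> x = g \<cdot> x" for X x
  proof (rule prod_eqI[OF A B comp_hom[OF x pf(1)] comp_hom[OF x pg(1)]])
    show "proj1 C A B \<cdot> (pairing C (Ident C A) f \<cdot> x) = proj1 C A B \<cdot> (pairing C (Ident C A) g \<cdot> x)"
      using comp_assoc[OF x pf(1) pr(1)] comp_assoc[OF x pg(1) pr(1)] pf(2) pg(2) by simp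
    show "proj2 C A B \<cdot> (pairing C (Ident C A) f \<cdot> x) = proj2 C A B \<cdot> (pairing C (Ident C A) g \<cdot> x)"
      using comp_assoc[OF x pf(1) pr(2)] comp_assoc[OF x pg(1) pr(2)] pf(3) pg(3) eq by simp
  qed
  have sq: "pairing C (Ident C A) f \<cdot> e = pairing C (Ident C A) g \<cdot> e'"
    using pb unfolding is_pullback_def by blast
  then have ee: "e = e'" "f \<cdot> e = g \<cdot> e"
    using comps[OF e] by auto
  have "\<exists>!h. h \<in> hom C X E \<and> e \<cdot> h = x" if x: "x \<in> hom C X A" and eq: "f \<cdot> x = g \<cdot> x" for X x
    using pullback_universal[OF pb e x x pairs[OF x eq]] ee by simp
  then have "is_equalizer C e f g"
    unfolding is_equalizer_def using e(1) f g ee(2)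
    by (intro exI[of _ E] exI[of _ A] exI[of _ B]) simp
  then show ?thesis
    by blast
qed

lemma factors_equalizer_iff:
  assumes e: "is_equalizer C e f g" and a: "a \<in> hom C X (Cod C e)"
  shows "factors_through C a e \<longleftrightarrow> f \<cdot> a = g \<cdot> a"
proof -
  obtain E A B where h: "e \<in> hom C E A" "f \<in> hom C A B" "g \<in> hom C A B" "f \<cdot> e = g \<cdot> e"
    and u: "\<forall>X\<in>Obj C. \<forall>a\<in>hom C X A. f \<cdot> a = g \<cdot> a \<longrightarrow> (\<exists>!h. h \<in> hom C X E \<and> e \<cdot> h = a)"
    using e unfolding is_equalizer_def by (elim exE conjE)
  have a: "a \<in> hom C X A"
    using a homD(3)[OF h(1)] by simp
  show ?thesis
  proof
    assume "factors_through C a e"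
    then obtain k where k: "k \<in> hom C X E" "e \<cdot> k = a"
      by (rule factors_throughE[OF _ a h(1)])
    show "f \<cdot> a = g \<cdot> a"
      using comp_assoc[OF k(1) h(1,2)] comp_assoc[OF k(1) h(1,3)] h(4) k(2) by simp
  next
    assume "f \<cdot> a = g \<cdot> a"
    then have "\<exists>!h. h \<in> hom C X E \<and> e \<cdot> h = a"
      using u a hom_obj(1)[OF a] by simp
    then obtain k where "k \<in> hom C X E" "e \<cdot> k = a"
      by auto
    then show "factors_through C a e"
      by (intro factors_throughI[OF _ h(1) a])
  qed
qed

lemma mono_equalizer:
  assumes "is_equalizer C e f g"
  shows "mono_arr C e"
proof -
  obtain E A B where h: "e \<in> hom C E A" "f \<in> hom C A B" "g \<in> hom C A B" "f \<cdot> e = g \<cdot> e"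
    and u: "\<forall>X\<in>Obj C. \<forall>a\<in>hom C X A. f \<cdot> a = g \<cdot> a \<longrightarrow> (\<exists>!h. h \<in> hom C X E \<and> e \<cdot> h = a)"
    using assms unfolding is_equalizer_def by (elim exE conjE)
  show ?thesis
  proof (rule mono_arrI[OF h(1)])
    fix X x y
    assume x: "x \<in> hom C X E" and y: "y \<in> hom C X E" and eq: "e \<cdot> x = e \<cdot> y"
    have "f \<cdot> (e \<cdot> x) = g \<cdot> (e \<cdot> x)"
      using comp_assoc[OF x h(1,2)] comp_assoc[OF x h(1,3)] h(4) by simp
    then have "\<exists>!h. h \<in> hom C X E \<and> e \<cdot> h = e \<cdot> x"
      using u comp_hom[OF x h(1)] hom_obj(1)[OF x] by simp
    then show "x = y"
      using x y eq by auto
  qed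
qed

lemma Omega_obj: "Omega C \<in> Obj C"
  by (rule hom_obj(2)[OF truth_hom])

abbreviation "\<Omega>\<Omega> \<equiv> prod_obj C (Omega C) (Omega C)"
abbreviation "\<pi>1 \<equiv> proj1 C (Omega C) (Omega C)"
abbreviation "\<pi>2 \<equiv> proj2 C (Omega C) (Omega C)"

lemmas \<pi>_hom = proj_hom[OF Omega_obj Omega_obj]

lemma conj_op_classifies: "classifies C (conj_op C) (pairing C (truth C) (truth C))"
proof -
  obtain \<chi> where \<chi>: "classifies C \<chi> (pairing C (truth C) (truth C))"
    using classifier_of_mono[OF mono_from_one[OF pairing(1)[OF truth_hom truth_hom]]] .
  show ?thesis
    unfolding conj_op_def by (rule theI, fact \<chi>) (rule classifies_unique[OF _ \<chi>])
qed

lemma conj_op_hom: "conj_op C \<in> hom C \<Omega>\<Omega> (Omega C)"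
  using classifies_hom(2)[OF conj_op_classifies] homD(3)[OF pairing(1)[OF truth_hom truth_hom]]
  by simp

text \<open>If both components of \<open>a\<close> are true, the two witnesses are arrows to the terminal object and
  therefore coincide, so \<open>a\<close> factors through the pair \<open>\<langle>true, true\<rangle>\<close>.\<close>

lemma holds_conj_iff:
  assumes a: "a \<in> hom C X \<Omega>\<Omega>"
  shows "holds (conj_op C \<cdot> a) \<longleftrightarrow> holds (\<pi>1 \<cdot> a) \<and> holds (\<pi>2 \<cdot> a)"
proof -
  let ?tt = "pairing C (truth C) (truth C)"
  note tt = pairing[OF truth_hom truth_hom]
  have "holds (conj_op C \<cdot> a) \<longleftrightarrow> factors_through C a ?tt"
    using holds_iff_factors[OF conj_op_classifies] a homD(3)[OF tt(1)] by simp
  also have "\<dots> \<longleftrightarrow> holds (\<pi>1 \<cdot> a) \<and> holds (\<pi>2 \<cdot> a)"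
  proof
    assume "factors_through C a ?tt"
    then obtain k where k: "k \<in> hom C X one" "?tt \<cdot> k = a"
      by (rule factors_throughE[OF _ a tt(1)])
    have "truth C \<cdot> k = \<pi>1 \<cdot> a" "truth C \<cdot> k = \<pi>2 \<cdot> a"
      using comp_assoc[OF k(1) tt(1) \<pi>_hom(1)] comp_assoc[OF k(1) tt(1) \<pi>_hom(2)] k(2) tt by simp_all
    then show "holds (\<pi>1 \<cdot> a) \<and> holds (\<pi>2 \<cdot> a)"
      using factors_throughI[OF k(1) truth_hom] comp_hom[OF a \<pi>_hom(1)] comp_hom[OF a \<pi>_hom(2)]
      by simp
  next
    assume *: "holds (\<pi>1 \<cdot> a) \<and> holds (\<pi>2 \<cdot> a)"
    obtain k where k: "k \<in> hom C X one" "truth C \<cdot> k = \<pi>1 \<cdot> a"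
      using factors_throughE[OF _ comp_hom[OF a \<pi>_hom(1)] truth_hom] * by metis
    obtain l where l: "l \<in> hom C X one" "truth C \<cdot> l = \<pi>2 \<cdot> a"
      using factors_throughE[OF _ comp_hom[OF a \<pi>_hom(2)] truth_hom] * by metis
    have "?tt \<cdot> k = a"
    proof (rule prod_eqI[OF Omega_obj Omega_obj comp_hom[OF k(1) tt(1)] a])
      show "\<pi>1 \<cdot> (?tt \<cdot> k) = \<pi>1 \<cdot> a"
        using comp_assoc[OF k(1) tt(1) \<pi>_hom(1)] tt(2) k(2) by simp
      show "\<pi>2 \<cdot> (?tt \<cdot> k) = \<pi>2 \<cdot> a"
        using comp_assoc[OF k(1) tt(1) \<pi>_hom(2)] tt(3) l(2) to_one_unique[OF k(1) l(1)] by simp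
    qed
    then show "factors_through C a ?tt"
      by (rule factors_throughI[OF k(1) tt(1) a])
  qed
  finally show ?thesis .
qed

text \<open>The description of \<open>imp_op\<close> leaves the equalizer open; any two have the same elements, so by
  \<open>formula_eqI\<close> they give the same classifying arrow.\<close>

lemma imp_op_classifies:
  obtains e where "is_equalizer C e (conj_op C) \<pi>1" "classifies C (imp_op C) e"
proof -
  obtain e where e: "is_equalizer C e (conj_op C) \<pi>1"
    using equalizer_exists[OF conj_op_hom \<pi>_hom(1)] by blast
  obtain \<chi> where \<chi>: "classifies C \<chi> e"
    using classifier_of_mono[OF mono_equalizer[OF e]] .
  have cod: "Cod C e' = \<Omega>\<Omega>" if "is_equalizer C e' (conj_op C) \<pi>1" for e'
    using that homD[OF \<pi>_hom(1)] homD unfolding is_equalizer_def by metis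
  have "\<chi>' = \<chi>" if e': "is_equalizer C e' (conj_op C) \<pi>1" and \<chi>': "classifies C \<chi>' e'" for \<chi>' e'
  proof (rule formula_eqI)
    show "\<chi>' \<in> hom C \<Omega>\<Omega> (Omega C)" "\<chi> \<in> hom C \<Omega>\<Omega> (Omega C)"
      using classifies_hom(2)[OF \<chi>] classifies_hom(2)[OF \<chi>'] cod[OF e] cod[OF e'] by simp_all
    show "holds (\<chi>' \<cdot> a) \<longleftrightarrow> holds (\<chi> \<cdot> a)" if "a \<in> hom C Y \<Omega>\<Omega>" for Y a
      using that holds_iff_factors[OF \<chi>] holds_iff_factors[OF \<chi>'] factors_equalizer_iff[OF e]
        factors_equalizer_iff[OF e'] cod[OF e] cod[OF e'] by simp
  qed
  then have "\<exists>!\<chi>. \<exists>e. is_equalizer C e (conj_op C) \<pi>1 \<and> classifies C \<chi> e"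
    using e \<chi> by blast
  from theI'[OF this] show thesis
    using that unfolding imp_op_def by blast
qed

lemma imp_op_hom: "imp_op C \<in> hom C \<Omega>\<Omega> (Omega C)"
proof -
  obtain e where e: "is_equalizer C e (conj_op C) \<pi>1" "classifies C (imp_op C) e"
    using imp_op_classifies .
  have "Cod C e = \<Omega>\<Omega>"
    using e(1) homD[OF \<pi>_hom(1)] homD unfolding is_equalizer_def by metis
  then show ?thesis
    using classifies_hom(2)[OF e(2)] by simp
qed

text \<open>With \<open>p\<close> and \<open>q\<close> the components of \<open>a\<close>, the implication is true at \<open>a\<close> when \<open>p \<and> q\<close> and \<open>p\<close> are
  the same formula on the domain of \<open>a\<close>; extensionality turns this equality into a
  statement about all further stages \<open>b\<close>.\<close>

lemma holds_imp_op_iff: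
  assumes a: "a \<in> hom C X \<Omega>\<Omega>"
  shows "holds (imp_op C \<cdot> a) \<longleftrightarrow>
    (\<forall>Y. \<forall>b\<in>hom C Y X. holds ((\<pi>1 \<cdot> a) \<cdot> b) \<longrightarrow> holds ((\<pi>2 \<cdot> a) \<cdot> b))"
proof -
  obtain e where e: "is_equalizer C e (conj_op C) \<pi>1" "classifies C (imp_op C) e"
    using imp_op_classifies .
  have cod: "Cod C e = \<Omega>\<Omega>"
    using homD(2)[OF classifies_hom(2)[OF e(2)]] homD(2)[OF imp_op_hom] by simp
  have c: "holds ((conj_op C \<cdot> a) \<cdot> b) \<longleftrightarrow> holds ((\<pi>1 \<cdot> a) \<cdot> b) \<and> holds ((\<pi>2 \<cdot> a) \<cdot> b)"
    if b: "b \<in> hom C Y X" for Y b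
    using holds_conj_iff[OF comp_hom[OF b a]] comp_assoc[OF b a \<pi>_hom(1)]
      comp_assoc[OF b a \<pi>_hom(2)] comp_assoc[OF b a conj_op_hom] by simp
  have "holds (imp_op C \<cdot> a) \<longleftrightarrow> conj_op C \<cdot> a = \<pi>1 \<cdot> a"
    using holds_iff_factors[OF e(2)] factors_equalizer_iff[OF e(1)] a cod by simp
  also have "\<dots> \<longleftrightarrow> (\<forall>Y. \<forall>b\<in>hom C Y X. holds ((conj_op C \<cdot> a) \<cdot> b) \<longleftrightarrow> holds ((\<pi>1 \<cdot> a) \<cdot> b))"
    using formula_eqI[OF comp_hom[OF a conj_op_hom] comp_hom[OF a \<pi>_hom(1)]] by auto
  finally show ?thesis
    using c by auto
qed

lemma imp_form_hom:
  assumes p: "p \<in> hom C X (Omega C)" and q: "q \<in> hom C X (Omega C)"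
  shows "imp_form C p q \<in> hom C X (Omega C)"
  unfolding imp_form_def by (rule comp_hom[OF pairing(1)[OF p q] imp_op_hom])

lemma holds_imp_form_iff:
  assumes p: "p \<in> hom C X (Omega C)" and q: "q \<in> hom C X (Omega C)" and a: "a \<in> hom C Y X"
  shows "holds (imp_form C p q \<cdot> a) \<longleftrightarrow>
    (\<forall>Z. \<forall>b\<in>hom C Z Y. holds (p \<cdot> (a \<cdot> b)) \<longrightarrow> holds (q \<cdot> (a \<cdot> b)))"
proof -
  note pq = pairing[OF p q]
  have "(\<pi>1 \<cdot> (pairing C p q \<cdot> a)) \<cdot> b = p \<cdot> (a \<cdot> b)" "(\<pi>2 \<cdot> (pairing C p q \<cdot> a)) \<cdot> b = q \<cdot> (a \<cdot> b)"
    if b: "b \<in> hom C Z Y" for Z b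
    using comp_assoc[OF a pq(1) \<pi>_hom(1)] comp_assoc[OF a pq(1) \<pi>_hom(2)] pq(2,3)
      comp_assoc[OF b a p] comp_assoc[OF b a q] by simp_all
  then show ?thesis
    unfolding imp_form_def comp_assoc[OF a pq(1) imp_op_hom]
    using holds_imp_op_iff[OF comp_hom[OF a pq(1)]] by simp
qed

end

section \<open>Loeb induction in terms of subobjects\<close>

text \<open>The pullback of \<open>\<triangleright>u\<close> along \<open>next\<close> is contained in \<open>u\<close>, expressed without choosing a pullback.\<close>

definition later_closed :: "('o, 'm) precategory \<Rightarrow> ('o, 'm) later_data \<Rightarrow> 'm \<Rightarrow> bool" where
  "later_closed C M u \<longleftrightarrow> (\<forall>Y. \<forall>b\<in>hom C Y (Cod C u).
     factors_through C (nxt M (Cod C u) \<cdot>\<^bsub>C\<^esub> b) (on_arr (later M) u) \<longrightarrow> factors_through C b u)"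

text \<open>A subobject is everything exactly when the identity factors through it.\<close>

definition external_loeb :: "('o, 'm) precategory \<Rightarrow> ('o, 'm) later_data \<Rightarrow> bool" where
  "external_loeb C M \<longleftrightarrow> (\<forall>u. mono_arr C u \<and> later_closed C M u \<longrightarrow>
     factors_through C (Ident C (Cod C u)) u)"

locale later_modality = category C for C :: "('o, 'm) precategory" (structure) +
  fixes M :: "('o, 'm) later_data"
  assumes later_structure: "later_structure C M"
begin

lemma later_left_exact: "left_exact C C (later M)"
  using later_structure by (simp add: later_structure_def)

lemma later_functor: "is_functor C C (later M)"
  using later_left_exact by (simp add: left_exact_def)

lemma nxt_hom:
  assumes "A \<in> Obj C"
  shows "nxt M A \<in> hom C A (on_obj (later M) A)"
  using nat_trans_hom[of C C id_functor "later M" "nxt M" A] later_structure assms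
  by (simp add: later_structure_def id_functor_def)

lemma nxt_natural:
  assumes "f \<in> hom C A B"
  shows "nxt M B \<cdot> f = on_arr (later M) f \<cdot> nxt M A"
  using nat_trans_natural[of C C id_functor "later M" "nxt M" f A B] later_structure assms
  by (simp add: later_structure_def id_functor_def)

lemma later_mono: "mono_arr C u \<Longrightarrow> mono_arr C (on_arr (later M) u)"
  by (rule left_exact_mono[OF category_axioms category_axioms later_left_exact])

end

locale later_category = classifying_category C + later_modality C M
  for C :: "('o, 'm) precategory" (structure) and M
begin

lemma classified_factor_each_other:
  assumes u: "classifies C \<phi> u" and v: "classifies C \<phi> v"
  shows "factors_through C u v"
proof -
  note uh = classifies_hom[OF u] and vh = classifies_hom[OF v]
  have cod: "Cod C u = Cod C v"
    using homD(2)[OF uh(2)] homD(2)[OF vh(2)] by simp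
  show ?thesis
    using holds_iff_factors[OF u uh(1)] factors_self[OF uh(1)] holds_iff_factors[OF v] uh(1) cod
    by simp
qed

lemma later_form_witness:
  assumes \<phi>: "\<phi> \<in> hom C X (Omega C)" and u: "classifies C \<phi> u"
    and pb: "is_pullback C v w (nxt M X) (on_arr (later M) u)" and \<chi>: "classifies C \<chi> v"
  shows "\<chi> \<in> hom C X (Omega C)"
    "a \<in> hom C Y X \<Longrightarrow>
      holds (\<chi> \<cdot> a) \<longleftrightarrow> factors_through C (nxt M X \<cdot> a) (on_arr (later M) u)"
proof -
  obtain P A B Z where h: "v \<in> hom C P A" "nxt M X \<in> hom C A Z"
    using pullbackE[OF pb] .
  have cod: "Cod C v = X"
    using homD(3)[OF h(1)] homD(2)[OF h(2)] homD(2)[OF nxt_hom[OF hom_obj(1)[OF \<phi>]]] by simp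
  then show "\<chi> \<in> hom C X (Omega C)"
    using classifies_hom(2)[OF \<chi>] by simp
  show "holds (\<chi> \<cdot> a) \<longleftrightarrow> factors_through C (nxt M X \<cdot> a) (on_arr (later M) u)"
    if "a \<in> hom C Y X"
    using holds_iff_factors[OF \<chi>] factors_pullback_iff[OF pb] that cod by simp
qed

lemma factors_later_independent:
  assumes \<phi>: "\<phi> \<in> hom C X (Omega C)" and u: "classifies C \<phi> u" and v: "classifies C \<phi> v"
    and a: "a \<in> hom C Y (on_obj (later M) X)" and f: "factors_through C a (on_arr (later M) u)"
  shows "factors_through C a (on_arr (later M) v)"
proof -
  have X: "Cod C u = X" "Cod C v = X"
    using homD(2)[OF \<phi>] homD(2)[OF classifies_hom(2)[OF u]] homD(2)[OF classifies_hom(2)[OF v]]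
    by simp_all
  have uh: "u \<in> hom C (Dom C u) X" and vh: "v \<in> hom C (Dom C v) X"
    using classifies_hom(1)[OF u] classifies_hom(1)[OF v] X by simp_all
  show ?thesis
    by (rule factors_trans[OF f functor_factors[OF later_functor
        classified_factor_each_other[OF u v] uh vh] a
        functor_hom[OF later_functor uh] functor_hom[OF later_functor vh]])
qed

text \<open>The description of \<open>later_form\<close> leaves both the subobject \<open>u\<close> and its pullback open.  Two
  subobjects classified by \<open>\<phi>\<close> factor through each other, hence so do their images under \<open>\<triangleright>\<close>; the
  truth condition does not depend on the choices, and \<open>formula_eqI\<close> gives uniqueness.\<close>

lemma later_form:
  assumes \<phi>: "\<phi> \<in> hom C X (Omega C)"
  shows "later_form C M \<phi> \<in> hom C X (Omega C)"
    and "\<lbrakk>classifies C \<phi> u; a \<in> hom C Y X\<rbrakk> \<Longrightarrow> holds (later_form C M \<phi> \<cdot> a) \<longleftrightarrow>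
      factors_through C (nxt M X \<cdot> a) (on_arr (later M) u)"
proof -
  note n = nxt_hom[OF hom_obj(1)[OF \<phi>]]
  define W where "W \<chi> u v w \<longleftrightarrow> classifies C \<phi> u \<and>
     is_pullback C v w (nxt M X) (on_arr (later M) u) \<and> classifies C \<chi> v" for \<chi> u v w
  obtain U m where m: "m \<in> hom C U X" "classifies C \<phi> m"
    using classified_mono[OF \<phi>] .
  obtain P v w where pb: "is_pullback C v w (nxt M X) (on_arr (later M) m)"
    using pullback_exists[OF finite_limits n functor_hom[OF later_functor m(1)]] by blast
  have "mono_arr C (on_arr (later M) m)"
    using m(2) later_mono by (simp add: classifies_def)
  then obtain \<chi> where \<chi>: "classifies C \<chi> v"
    using classifier_of_mono[OF mono_pullback[OF pb]] by metis
  have W: "W \<chi> m v w"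
    using m(2) pb \<chi> by (simp add: W_def)
  have hom: "\<chi> \<in> hom C X (Omega C)" if "W \<chi> u v w" for \<chi> u v w
    using that later_form_witness(1)[OF \<phi>] unfolding W_def by blast
  have iff: "holds (\<chi> \<cdot> a) \<longleftrightarrow> factors_through C (nxt M X \<cdot> a) (on_arr (later M) u')"
    if "W \<chi> u v w" "classifies C \<phi> u'" "a \<in> hom C Y X" for \<chi> u v w u' Y a
  proof -
    have "holds (\<chi> \<cdot> a) \<longleftrightarrow> factors_through C (nxt M X \<cdot> a) (on_arr (later M) u)"
      using that(1,3) later_form_witness(2)[OF \<phi>] unfolding W_def by blast
    then show ?thesis
      using factors_later_independent[OF \<phi> _ _ comp_hom[OF that(3) n]] that(1,2)
      unfolding W_def by blast
  qed
  have "\<exists>!\<chi>. \<exists>u v w. W \<chi> u v w"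
  proof (rule ex1I[of _ \<chi>])
    show "\<exists>u v w. W \<chi> u v w"
      using W by blast
    fix \<chi>'
    assume "\<exists>u v w. W \<chi>' u v w"
    then obtain u' v' w' where W': "W \<chi>' u' v' w'"
      by blast
    show "\<chi>' = \<chi>"
      by (rule formula_eqI[OF hom[OF W'] hom[OF W]]) (simp add: iff[OF W' m(2)] iff[OF W m(2)])
  qed
  from theI'[OF this] have "\<exists>u v w. W (later_form C M \<phi>) u v w"
    unfolding later_form_def homD(2)[OF \<phi>] W_def .
  then obtain u' v' w' where L: "W (later_form C M \<phi>) u' v' w'"
    by blast
  show "later_form C M \<phi> \<in> hom C X (Omega C)"
    by (rule hom[OF L])
  show "\<lbrakk>classifies C \<phi> u; a \<in> hom C Y X\<rbrakk> \<Longrightarrow> holds (later_form C M \<phi> \<cdot> a) \<longleftrightarrow>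
      factors_through C (nxt M X \<cdot> a) (on_arr (later M) u)"
    by (rule iff[OF L])
qed

lemma truth_classified: "classifies C (Ident C (Omega C)) (truth C)"
  by (rule classifiesI[OF mono_from_one[OF truth_hom] truth_hom ident_hom[OF Omega_obj]])
    (simp add: ident_comp)

abbreviation "later_\<Omega> \<equiv> later_form C M (Ident C (Omega C))"

text \<open>The Kripke--Joyal unfolding of the Loeb sequent; the formula \<open>a\<close> is an arbitrary element of
  \<open>\<Omega>\<close>, at which the sequent in context \<open>\<phi> : \<Omega>\<close> is evaluated.\<close>

lemma supports_loeb_iff_formulas:
  "supports_loeb C M \<longleftrightarrow> (\<forall>X. \<forall>a\<in>hom C X (Omega C).
     (\<forall>Y. \<forall>b\<in>hom C Y X. holds (later_\<Omega> \<cdot> (a \<cdot> b)) \<longrightarrow> holds (a \<cdot> b)) \<longrightarrow> holds a)"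
proof -
  note i = ident_hom[OF Omega_obj]
  note l = later_form(1)[OF i]
  have "holds (Ident C (Omega C) \<cdot> (a \<cdot> b)) \<longleftrightarrow> holds (a \<cdot> b)"
    if "a \<in> hom C X (Omega C)" "b \<in> hom C Y X" for X Y a b
    by (simp add: ident_comp[OF comp_hom[OF that(2,1)]])
  then show ?thesis
    unfolding supports_loeb_def Let_def sequent_iff[OF imp_form_hom[OF l i] i]
    using holds_imp_form_iff[OF l i] ident_comp by simp
qed

text \<open>The internal operator on \<open>\<Omega>\<close> computes the later modality on subobjects: \<open>\<triangleright>\<close> preserves the
  pullback square that exhibits \<open>u\<close> as the preimage of \<open>truth\<close> under \<open>\<chi>\<close>, and \<open>next\<close> is natural in
  \<open>\<chi>\<close>.\<close>

lemma later_truth_pullback_iff: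
  assumes \<chi>: "classifies C \<chi> u" and b: "b \<in> hom C Y (Cod C u)"
  shows "holds (later_\<Omega> \<cdot> (\<chi> \<cdot> b)) \<longleftrightarrow>
    factors_through C (nxt M (Cod C u) \<cdot> b) (on_arr (later M) u)"
proof -
  note uh = classifies_hom(1)[OF \<chi>] and \<chi>h = classifies_hom(2)[OF \<chi>]
  note n = nxt_hom[OF hom_obj(2)[OF uh]]
  obtain c where "is_pullback C u c \<chi> (truth C)"
    using \<chi> unfolding classifies_def by blast
  then have pb: "is_pullback C (on_arr (later M) u) (on_arr (later M) c) (on_arr (later M) \<chi>)
      (on_arr (later M) (truth C))"
    by (rule left_exact_pullback[OF category_axioms category_axioms later_left_exact])
  have "nxt M (Omega C) \<cdot> (\<chi> \<cdot> b) = on_arr (later M) \<chi> \<cdot> (nxt M (Cod C u) \<cdot> b)"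
    using comp_assoc[OF b \<chi>h nxt_hom[OF Omega_obj]] nxt_natural[OF \<chi>h]
      comp_assoc[OF b n functor_hom[OF later_functor \<chi>h]] by simp
  moreover have "nxt M (Cod C u) \<cdot> b \<in> hom C Y (Cod C (on_arr (later M) u))"
    using comp_hom[OF b n] homD(3)[OF functor_hom[OF later_functor uh]] by simp
  ultimately show ?thesis
    using later_form(2)[OF ident_hom[OF Omega_obj] truth_classified comp_hom[OF b \<chi>h]]
      factors_pullback_iff[OF pb] by simp
qed

text \<open>The subobject classified by a formula that satisfies the hypothesis of Loeb induction is
  later-closed, and conversely a later-closed subobject is classified by such a formula; that
  formula is true if and only if the subobject is everything.\<close>

theorem supports_loeb_iff_external: "supports_loeb C M \<longleftrightarrow> external_loeb C M"
proof
  assume L: "supports_loeb C M"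
  show "external_loeb C M"
    unfolding external_loeb_def
  proof (intro allI impI, elim conjE)
    fix u
    assume mono: "mono_arr C u" and cl: "later_closed C M u"
    obtain \<chi> where \<chi>: "classifies C \<chi> u"
      using classifier_of_mono[OF mono] .
    note \<chi>h = classifies_hom(2)[OF \<chi>]
    have "holds (later_\<Omega> \<cdot> (\<chi> \<cdot> b)) \<longrightarrow> holds (\<chi> \<cdot> b)" if b: "b \<in> hom C Y (Cod C u)" for Y b
      using later_truth_pullback_iff[OF \<chi> b] holds_iff_factors[OF \<chi> b] cl b
      unfolding later_closed_def by blast
    then have "holds \<chi>"
      using L \<chi>h unfolding supports_loeb_iff_formulas by blast
    then show "factors_through C (Ident C (Cod C u)) u"
      using holds_iff_factors[OF \<chi> ident_hom[OF hom_obj(1)[OF \<chi>h]]] comp_ident[OF \<chi>h] by simp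
  qed
next
  assume E: "external_loeb C M"
  show "supports_loeb C M"
    unfolding supports_loeb_iff_formulas
  proof (intro allI ballI impI)
    fix X a
    assume a: "a \<in> hom C X (Omega C)"
      and hyp: "\<forall>Y. \<forall>b\<in>hom C Y X. holds (later_\<Omega> \<cdot> (a \<cdot> b)) \<longrightarrow> holds (a \<cdot> b)"
    obtain U u where u: "u \<in> hom C U X" "classifies C a u"
      using classified_mono[OF a] .
    have X: "Cod C u = X"
      by (rule homD(3)[OF u(1)])
    have "later_closed C M u"
      unfolding later_closed_def
    proof (intro allI ballI impI)
      fix Y b
      assume b: "b \<in> hom C Y (Cod C u)"
        and f: "factors_through C (nxt M (Cod C u) \<cdot> b) (on_arr (later M) u)"
      then have "holds (a \<cdot> b)"
        using hyp later_truth_pullback_iff[OF u(2) b] X by simp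
      then show "factors_through C b u"
        using holds_iff_factors[OF u(2) b] by simp
    qed
    then have "factors_through C (Ident C X) u"
      using E u(2) X unfolding external_loeb_def classifies_def by blast
    then show "holds a"
      using holds_iff_factors[OF u(2), of "Ident C X" X] ident_hom[OF hom_obj(1)[OF a]] X
        comp_ident[OF a] by simp
  qed
qed

end

section \<open>Adjunctions and limits\<close>

locale adjoint_pair = S: category S + T: category T
  for S :: "('o, 'm) precategory" and T :: "('p, 'n) precategory" +
  fixes F :: "('o, 'm, 'p, 'n) functor_data" and G :: "('p, 'n, 'o, 'm) functor_data"
    and \<eta> :: "'o \<Rightarrow> 'm" and \<epsilon> :: "'p \<Rightarrow> 'n"
  assumes adj: "adjunction S T F G \<eta> \<epsilon>"
begin

lemma F_functor: "is_functor S T F"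
  and G_functor: "is_functor T S G"
  using adj by (simp_all add: adjunction_def)

lemma unit_hom:
  assumes "A \<in> Obj S"
  shows "\<eta> A \<in> hom S A (on_obj G (on_obj F A))"
  using nat_trans_hom[of S S id_functor "G \<circ>\<^sub>F F" \<eta> A] adj assms
  by (simp add: adjunction_def id_functor_def comp_functor_def)

lemma unit_natural:
  assumes "f \<in> hom S A B"
  shows "\<eta> B \<cdot>\<^bsub>S\<^esub> f = on_arr G (on_arr F f) \<cdot>\<^bsub>S\<^esub> \<eta> A"
  using nat_trans_natural[of S S id_functor "G \<circ>\<^sub>F F" \<eta> f A B] adj assms
  by (simp add: adjunction_def id_functor_def comp_functor_def)

lemma counit_hom:
  assumes "B \<in> Obj T"
  shows "\<epsilon> B \<in> hom T (on_obj F (on_obj G B)) B"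
  using nat_trans_hom[of T T "F \<circ>\<^sub>F G" id_functor \<epsilon> B] adj assms
  by (simp add: adjunction_def id_functor_def comp_functor_def)

lemma counit_natural:
  assumes "f \<in> hom T A B"
  shows "\<epsilon> B \<cdot>\<^bsub>T\<^esub> on_arr F (on_arr G f) = f \<cdot>\<^bsub>T\<^esub> \<epsilon> A"
  using nat_trans_natural[of T T "F \<circ>\<^sub>F G" id_functor \<epsilon> f A B] adj assms
  by (simp add: adjunction_def id_functor_def comp_functor_def)

lemma triangle_F:
  assumes "A \<in> Obj S"
  shows "\<epsilon> (on_obj F A) \<cdot>\<^bsub>T\<^esub> on_arr F (\<eta> A) = Ident T (on_obj F A)"
  using adj assms by (simp add: adjunction_def)

lemma triangle_G:
  assumes "B \<in> Obj T"
  shows "on_arr G (\<epsilon> B) \<cdot>\<^bsub>S\<^esub> \<eta> (on_obj G B) = Ident S (on_obj G B)"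
  using adj assms by (simp add: adjunction_def)

text \<open>Transposition along the adjunction, in the two directions.\<close>

definition flat :: "'p \<Rightarrow> 'm \<Rightarrow> 'n" where
  "flat A f = \<epsilon> A \<cdot>\<^bsub>T\<^esub> on_arr F f"

definition sharp :: "'o \<Rightarrow> 'n \<Rightarrow> 'm" where
  "sharp X h = on_arr G h \<cdot>\<^bsub>S\<^esub> \<eta> X"

lemma flat_hom:
  assumes "f \<in> hom S X (on_obj G A)" "A \<in> Obj T"
  shows "flat A f \<in> hom T (on_obj F X) A"
  unfolding flat_def by (rule T.comp_hom[OF functor_hom[OF F_functor assms(1)] counit_hom[OF assms(2)]])

lemma sharp_hom:
  assumes "h \<in> hom T (on_obj F X) A" "X \<in> Obj S"
  shows "sharp X h \<in> hom S X (on_obj G A)"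
  unfolding sharp_def by (rule S.comp_hom[OF unit_hom[OF assms(2)] functor_hom[OF G_functor assms(1)]])

lemma sharp_flat:
  assumes f: "f \<in> hom S X (on_obj G A)" and A: "A \<in> Obj T"
  shows "sharp X (flat A f) = f"
proof -
  note X = S.hom_obj(1)[OF f]
  note Ff = functor_hom[OF F_functor f] and e = counit_hom[OF A]
  note GFf = functor_hom[OF G_functor Ff] and Ge = functor_hom[OF G_functor e]
  have "sharp X (flat A f) = (on_arr G (\<epsilon> A) \<cdot>\<^bsub>S\<^esub> on_arr G (on_arr F f)) \<cdot>\<^bsub>S\<^esub> \<eta> X"
    by (simp add: sharp_def flat_def functor_comp_arr[OF G_functor Ff e])
  also have "\<dots> = on_arr G (\<epsilon> A) \<cdot>\<^bsub>S\<^esub> (\<eta> (on_obj G A) \<cdot>\<^bsub>S\<^esub> f)"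
    by (simp add: S.comp_assoc[OF unit_hom[OF X] GFf Ge] unit_natural[OF f])
  also have "\<dots> = f"
    by (simp add: S.comp_assoc[OF f unit_hom[OF S.hom_obj(2)[OF f]] Ge, symmetric]
        triangle_G[OF A] S.ident_comp[OF f])
  finally show ?thesis .
qed

lemma flat_comp:
  assumes f: "f \<in> hom S X (on_obj G A)" and u: "u \<in> hom T A B"
  shows "flat B (on_arr G u \<cdot>\<^bsub>S\<^esub> f) = u \<cdot>\<^bsub>T\<^esub> flat A f"
proof -
  note Gu = functor_hom[OF G_functor u]
  note FGu = functor_hom[OF F_functor Gu] and Ff = functor_hom[OF F_functor f]
  note A = T.hom_obj(1)[OF u] and B = T.hom_obj(2)[OF u]
  show ?thesis
    by (simp add: flat_def functor_comp_arr[OF F_functor f Gu]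
        T.comp_assoc[OF Ff FGu counit_hom[OF B], symmetric] counit_natural[OF u]
        T.comp_assoc[OF Ff counit_hom[OF A] u])
qed

lemma sharp_comp:
  assumes h: "h \<in> hom T (on_obj F X) A" and u: "u \<in> hom T A B" and X: "X \<in> Obj S"
  shows "sharp X (u \<cdot>\<^bsub>T\<^esub> h) = on_arr G u \<cdot>\<^bsub>S\<^esub> sharp X h"
  unfolding sharp_def functor_comp_arr[OF G_functor h u]
  by (rule S.comp_assoc[OF unit_hom[OF X] functor_hom[OF G_functor h] functor_hom[OF G_functor u]])

text \<open>A cone over \<open>G K\<close> with vertex \<open>X\<close> is transposed to a cone over \<open>K\<close> with vertex \<open>F X\<close>, and the
  mediating arrow is transposed back.\<close>

lemma right_adjoint_left_exact: "left_exact T S G"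
  unfolding left_exact_def
proof (intro conjI allI impI G_functor, elim conjE)
  fix J :: "(nat, nat) precategory" and K A \<pi>
  assume J: "finite_shape J" and K: "is_functor J T K" and lim: "limit_cone T J K A \<pi>"
  interpret J: category J
    using J by (simp add: finite_shape_def)
  have A: "A \<in> Obj T" and \<pi>: "\<And>i. i \<in> Obj J \<Longrightarrow> \<pi> i \<in> hom T A (on_obj K i)"
    and \<pi>_eq: "\<And>i k u. u \<in> hom J i k \<Longrightarrow> on_arr K u \<cdot>\<^bsub>T\<^esub> \<pi> i = \<pi> k"
    using lim by (simp_all add: limit_cone_def cone_def)
  show "limit_cone S J (G \<circ>\<^sub>F K) (on_obj G A) (\<lambda>i. on_arr G (\<pi> i))"
    unfolding limit_cone_def
  proof (intro conjI allI impI)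
    show "cone S J (G \<circ>\<^sub>F K) (on_obj G A) (\<lambda>i. on_arr G (\<pi> i))"
      unfolding cone_def comp_functor_def functor_data.simps
    proof (intro conjI ballI allI functor_obj[OF G_functor A] functor_hom[OF G_functor] \<pi>)
      fix i k u
      assume u: "u \<in> hom J i k"
      show "on_arr G (on_arr K u) \<cdot>\<^bsub>S\<^esub> on_arr G (\<pi> i) = on_arr G (\<pi> k)"
        using functor_comp_arr[OF G_functor \<pi>[OF J.hom_obj(1)[OF u]] functor_hom[OF K u]]
          \<pi>_eq[OF u] by simp
    qed
    fix X \<rho>
    assume "cone S J (G \<circ>\<^sub>F K) X \<rho>"
    then have X: "X \<in> Obj S" and \<rho>: "\<And>i. i \<in> Obj J \<Longrightarrow> \<rho> i \<in> hom S X (on_obj G (on_obj K i))"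
      and \<rho>_eq: "\<And>i k u. u \<in> hom J i k \<Longrightarrow> on_arr G (on_arr K u) \<cdot>\<^bsub>S\<^esub> \<rho> i = \<rho> k"
      by (simp_all add: cone_def comp_functor_def)
    note Ko = functor_obj[OF K]
    have "cone T J K (on_obj F X) (\<lambda>i. flat (on_obj K i) (\<rho> i))"
      unfolding cone_def
    proof (intro conjI ballI allI functor_obj[OF F_functor X])
      show "flat (on_obj K i) (\<rho> i) \<in> hom T (on_obj F X) (on_obj K i)" if "i \<in> Obj J" for i
        by (rule flat_hom[OF \<rho>[OF that] Ko[OF that]])
      show "on_arr K u \<cdot>\<^bsub>T\<^esub> flat (on_obj K i) (\<rho> i) = flat (on_obj K k) (\<rho> k)"
        if u: "u \<in> hom J i k" for i k u
        using flat_comp[OF \<rho>[OF J.hom_obj(1)[OF u]] functor_hom[OF K u]] \<rho>_eq[OF u] by simp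
    qed
    then have "\<exists>!h. h \<in> hom T (on_obj F X) A \<and>
        (\<forall>i\<in>Obj J. \<pi> i \<cdot>\<^bsub>T\<^esub> h = flat (on_obj K i) (\<rho> i))"
      using lim unfolding limit_cone_def by simp
    then obtain h where hc: "h \<in> hom T (on_obj F X) A \<and>
          (\<forall>i\<in>Obj J. \<pi> i \<cdot>\<^bsub>T\<^esub> h = flat (on_obj K i) (\<rho> i))"
      and h_unique: "\<forall>h'. h' \<in> hom T (on_obj F X) A \<and>
          (\<forall>i\<in>Obj J. \<pi> i \<cdot>\<^bsub>T\<^esub> h' = flat (on_obj K i) (\<rho> i)) \<longrightarrow> h' = h"
      by (elim ex1E)
    from hc have h: "h \<in> hom T (on_obj F X) A"
      and h_eq: "\<And>i. i \<in> Obj J \<Longrightarrow> \<pi> i \<cdot>\<^bsub>T\<^esub> h = flat (on_obj K i) (\<rho> i)"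
      by simp_all
    show "\<exists>!h. h \<in> hom S X (on_obj G A) \<and> (\<forall>i\<in>Obj J. on_arr G (\<pi> i) \<cdot>\<^bsub>S\<^esub> h = \<rho> i)"
    proof (rule ex1I[of _ "sharp X h"])
      show "sharp X h \<in> hom S X (on_obj G A) \<and>
          (\<forall>i\<in>Obj J. on_arr G (\<pi> i) \<cdot>\<^bsub>S\<^esub> sharp X h = \<rho> i)"
        using sharp_hom[OF h X] sharp_comp[OF h \<pi> X, symmetric] h_eq sharp_flat[OF \<rho> Ko] by simp
      fix g
      assume g: "g \<in> hom S X (on_obj G A) \<and> (\<forall>i\<in>Obj J. on_arr G (\<pi> i) \<cdot>\<^bsub>S\<^esub> g = \<rho> i)"
      then have gh: "g \<in> hom S X (on_obj G A)"
        and g_eq: "\<And>i. i \<in> Obj J \<Longrightarrow> on_arr G (\<pi> i) \<cdot>\<^bsub>S\<^esub> g = \<rho> i"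
        by simp_all
      have fg_eq: "\<pi> i \<cdot>\<^bsub>T\<^esub> flat A g = flat (on_obj K i) (\<rho> i)" if "i \<in> Obj J" for i
        using flat_comp[OF gh \<pi>[OF that]] g_eq[OF that] by simp
      have "flat A g = h"
        by (rule h_unique[rule_format]) (use flat_hom[OF gh A] fg_eq in simp)
      then show "g = sharp X h"
        using sharp_flat[OF gh A] by simp
    qed
  qed
qed

end

section \<open>Localizing a later modality\<close>

locale localization = adjoint_pair S T F G \<eta> \<epsilon>
  for S :: "('o, 'm) precategory" and T :: "('p, 'n) precategory" and F G \<eta> \<epsilon> +
  assumes F_left_exact: "left_exact S T F"
    and G_fully_faithful: "fully_faithful T S G"
begin

lemma G_full:
  assumes "A \<in> Obj T" "B \<in> Obj T" "f \<in> hom S (on_obj G A) (on_obj G B)"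
  obtains g where "g \<in> hom T A B" "on_arr G g = f"
proof -
  have "bij_betw (on_arr G) (hom T A B) (hom S (on_obj G A) (on_obj G B))"
    using G_fully_faithful assms(1,2) by (simp add: fully_faithful_def)
  from bij_betw_imp_surj_on[OF this] have "f \<in> on_arr G ` hom T A B"
    using assms(3) by simp
  then show thesis
    using that by auto
qed

lemma G_faithful:
  assumes "f \<in> hom T A B" "g \<in> hom T A B" "on_arr G f = on_arr G g"
  shows "f = g"
proof -
  have "bij_betw (on_arr G) (hom T A B) (hom S (on_obj G A) (on_obj G B))"
    using G_fully_faithful T.hom_obj[OF assms(1)] by (simp add: fully_faithful_def)
  from inj_onD[OF bij_betw_imp_inj_on[OF this] assms(3,1,2)] show ?thesis .
qed

abbreviation "\<epsilon>inv B \<equiv> inverse_arr T (\<epsilon> B)"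

text \<open>The inverse of the counit at \<open>B\<close> is the arrow \<open>i\<close> which \<open>G\<close> sends to the unit at \<open>G B\<close>.  Each
  triangle identity gives one of the two inverse laws: one directly after naturality of the counit
  along \<open>i\<close>, the other after applying the faithful functor \<open>G\<close>.\<close>

lemma counit_inverse:
  assumes B: "B \<in> Obj T"
  shows "\<epsilon>inv B \<in> hom T B (on_obj F (on_obj G B))"
    "\<epsilon>inv B \<cdot>\<^bsub>T\<^esub> \<epsilon> B = Ident T (on_obj F (on_obj G B))" "\<epsilon> B \<cdot>\<^bsub>T\<^esub> \<epsilon>inv B = Ident T B"
    "on_arr G (\<epsilon>inv B) = \<eta> (on_obj G B)"
proof -
  note GB = functor_obj[OF G_functor B]
  note FGB = functor_obj[OF F_functor GB]
  note e = counit_hom[OF B]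
  obtain i where i: "i \<in> hom T B (on_obj F (on_obj G B))" and Gi: "on_arr G i = \<eta> (on_obj G B)"
    using G_full[OF B FGB unit_hom[OF GB]] .
  have ie: "i \<cdot>\<^bsub>T\<^esub> \<epsilon> B = Ident T (on_obj F (on_obj G B))"
    using counit_natural[OF i] triangle_F[OF GB] Gi by simp
  have ei: "\<epsilon> B \<cdot>\<^bsub>T\<^esub> i = Ident T B"
  proof (rule G_faithful[OF T.comp_hom[OF i e] T.ident_hom[OF B]])
    show "on_arr G (\<epsilon> B \<cdot>\<^bsub>T\<^esub> i) = on_arr G (Ident T B)"
      by (simp add: functor_comp_arr[OF G_functor i e] Gi triangle_G[OF B]
          functor_ident[OF G_functor B])
  qed
  have "\<epsilon>inv B = i"
    unfolding inverse_arr_def homD[OF e]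
  proof (rule the_equality)
    fix g
    assume "g \<in> hom T B (on_obj F (on_obj G B)) \<and>
      g \<cdot>\<^bsub>T\<^esub> \<epsilon> B = Ident T (on_obj F (on_obj G B)) \<and> \<epsilon> B \<cdot>\<^bsub>T\<^esub> g = Ident T B"
    then have g: "g \<in> hom T B (on_obj F (on_obj G B))" and ge: "\<epsilon> B \<cdot>\<^bsub>T\<^esub> g = Ident T B"
      by auto
    show "g = i"
      using T.comp_assoc[OF g e i] ie ge T.ident_comp[OF g] T.comp_ident[OF i] by simp
  qed (use i ie ei in simp)
  then show "\<epsilon>inv B \<in> hom T B (on_obj F (on_obj G B))"
    "\<epsilon>inv B \<cdot>\<^bsub>T\<^esub> \<epsilon> B = Ident T (on_obj F (on_obj G B))" "\<epsilon> B \<cdot>\<^bsub>T\<^esub> \<epsilon>inv B = Ident T B"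
    "on_arr G (\<epsilon>inv B) = \<eta> (on_obj G B)"
    using i ie ei Gi by simp_all
qed

lemma counit_inverse_natural:
  assumes f: "f \<in> hom T A B"
  shows "\<epsilon>inv B \<cdot>\<^bsub>T\<^esub> f = on_arr F (on_arr G f) \<cdot>\<^bsub>T\<^esub> \<epsilon>inv A"
proof (rule G_faithful)
  note A = T.hom_obj(1)[OF f] and B = T.hom_obj(2)[OF f]
  note i = counit_inverse[OF A] and j = counit_inverse[OF B]
  note Gf = functor_hom[OF G_functor f]
  note FGf = functor_hom[OF F_functor Gf]
  show "\<epsilon>inv B \<cdot>\<^bsub>T\<^esub> f \<in> hom T A (on_obj F (on_obj G B))"
    by (rule T.comp_hom[OF f j(1)])
  show "on_arr F (on_arr G f) \<cdot>\<^bsub>T\<^esub> \<epsilon>inv A \<in> hom T A (on_obj F (on_obj G B))"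
    by (rule T.comp_hom[OF i(1) FGf])
  show "on_arr G (\<epsilon>inv B \<cdot>\<^bsub>T\<^esub> f) = on_arr G (on_arr F (on_arr G f) \<cdot>\<^bsub>T\<^esub> \<epsilon>inv A)"
    by (simp add: functor_comp_arr[OF G_functor f j(1)] functor_comp_arr[OF G_functor i(1) FGf]
        i(4) j(4) unit_natural[OF Gf])
qed

lemma counit_inverse_of_reflected:
  assumes X: "X \<in> Obj S"
  shows "\<epsilon>inv (on_obj F X) = on_arr F (\<eta> X)"
proof -
  note FX = functor_obj[OF F_functor X]
  note i = counit_inverse[OF FX] and Fn = functor_hom[OF F_functor unit_hom[OF X]]
  show ?thesis
    using T.comp_assoc[OF Fn counit_hom[OF FX] i(1)] i(2) triangle_F[OF X] T.ident_comp[OF Fn]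
      T.comp_ident[OF i(1)] by simp
qed

end

locale localized_later_structure = localization S T F G \<eta> \<epsilon> + S: later_modality S M
  for S :: "('o, 'm) precategory" and T :: "('p, 'n) precategory" and F G \<eta> \<epsilon> M
begin

text \<open>The structure \<open>localized_later\<close>, stated for the components of the adjunction.\<close>

definition localized :: "('p, 'n) later_data" where
  "localized = \<lparr>later = F \<circ>\<^sub>F later M \<circ>\<^sub>F G,
     nxt = (\<lambda>A. on_arr F (nxt M (on_obj G A)) \<cdot>\<^bsub>T\<^esub> \<epsilon>inv A)\<rparr>"

abbreviation "D \<equiv> on_obj (later M)"
abbreviation "Da \<equiv> on_arr (later M)"

lemma localized_simps:
  "on_obj (later localized) A = on_obj F (D (on_obj G A))"
  "on_arr (later localized) f = on_arr F (Da (on_arr G f))"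
  "nxt localized A = on_arr F (nxt M (on_obj G A)) \<cdot>\<^bsub>T\<^esub> \<epsilon>inv A"
  by (simp_all add: localized_def comp_functor_def)

lemma localized_structure: "later_structure T localized"
  unfolding later_structure_def
proof
  show "left_exact T T (later localized)"
    unfolding localized_def later_data.simps
    by (rule left_exact_comp[OF left_exact_comp[OF right_adjoint_left_exact S.later_left_exact] F_left_exact])
  show "nat_trans T T id_functor (later localized) (nxt localized)"
    unfolding nat_trans_def localized_simps id_functor_def functor_data.simps
  proof (intro conjI ballI allI)
    fix A
    assume A: "A \<in> Obj T"
    show "on_arr F (nxt M (on_obj G A)) \<cdot>\<^bsub>T\<^esub> \<epsilon>inv A \<in> hom T A (on_obj F (D (on_obj G A)))"
      by (rule T.comp_hom[OF counit_inverse(1)[OF A]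
          functor_hom[OF F_functor S.nxt_hom[OF functor_obj[OF G_functor A]]]])
  next
    fix A B f
    assume f: "f \<in> hom T A B"
    note A = T.hom_obj(1)[OF f] and B = T.hom_obj(2)[OF f]
    note Gf = functor_hom[OF G_functor f]
    note nA = S.nxt_hom[OF functor_obj[OF G_functor A]]
      and nB = S.nxt_hom[OF functor_obj[OF G_functor B]]
    note DGf = functor_hom[OF S.later_functor Gf]
    note iA = counit_inverse(1)[OF A] and iB = counit_inverse(1)[OF B]
    note FGf = functor_hom[OF F_functor Gf] and FnA = functor_hom[OF F_functor nA]
      and FnB = functor_hom[OF F_functor nB] and FDGf = functor_hom[OF F_functor DGf]
    have "(on_arr F (nxt M (on_obj G B)) \<cdot>\<^bsub>T\<^esub> \<epsilon>inv B) \<cdot>\<^bsub>T\<^esub> f =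
        on_arr F (nxt M (on_obj G B) \<cdot>\<^bsub>S\<^esub> on_arr G f) \<cdot>\<^bsub>T\<^esub> \<epsilon>inv A"
      by (simp add: T.comp_assoc[OF f iB FnB] counit_inverse_natural[OF f]
          T.comp_assoc[OF iA FGf FnB] functor_comp_arr[OF F_functor Gf nB])
    also have "\<dots> = on_arr F (Da (on_arr G f)) \<cdot>\<^bsub>T\<^esub> (on_arr F (nxt M (on_obj G A)) \<cdot>\<^bsub>T\<^esub> \<epsilon>inv A)"
      by (simp add: S.nxt_natural[OF Gf] functor_comp_arr[OF F_functor nA DGf]
          T.comp_assoc[OF iA FnA FDGf])
    finally show "(on_arr F (nxt M (on_obj G B)) \<cdot>\<^bsub>T\<^esub> \<epsilon>inv B) \<cdot>\<^bsub>T\<^esub> f =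
        on_arr F (Da (on_arr G f)) \<cdot>\<^bsub>T\<^esub> (on_arr F (nxt M (on_obj G A)) \<cdot>\<^bsub>T\<^esub> \<epsilon>inv A)" .
  qed
qed

text \<open>Put \<open>X = G A\<close>.  Both sides equal \<open>F\<close> applied to \<open>\<triangleright>\<eta> \<cdot> \<triangleright>next\<close>, the first because
  \<open>G\<close> of the localized \<open>next\<close> is \<open>\<eta> \<cdot> next\<close>, the second because naturality of \<open>next\<close> along \<open>\<eta>\<close> at
  \<open>\<triangleright>X\<close> produces \<open>\<triangleright>\<eta> \<cdot> next\<close> and \<open>next\<close> at \<open>\<triangleright>X\<close> is \<open>\<triangleright>next\<close> at \<open>X\<close>.\<close>

lemma localized_well_pointed:
  assumes wp: "well_pointed S M"
  shows "well_pointed T localized"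
  unfolding well_pointed_def
proof
  fix A
  assume A: "A \<in> Obj T"
  let ?X = "on_obj G A"
  note X = functor_obj[OF G_functor A]
  note DX = functor_obj[OF S.later_functor X]
  note n = S.nxt_hom[OF X]
  note nD = S.nxt_hom[OF DX]
  note u = unit_hom[OF X] and uD = unit_hom[OF DX]
  note i = counit_inverse[OF A]
  note Fn = functor_hom[OF F_functor n]
  note GFn = functor_hom[OF G_functor Fn]
  have swap: "on_arr G (nxt localized A) = \<eta> (D ?X) \<cdot>\<^bsub>S\<^esub> nxt M ?X"
    unfolding localized_simps functor_comp_arr[OF G_functor i(1) Fn] i(4) unit_natural[OF n] ..
  have nGFD: "nxt M (on_obj G (on_obj F (D ?X))) \<cdot>\<^bsub>S\<^esub> \<eta> (D ?X) = Da (\<eta> (D ?X)) \<cdot>\<^bsub>S\<^esub> nxt M (D ?X)"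
    by (rule S.nxt_natural[OF uD])
  note nGF = S.nxt_hom[OF S.hom_obj(2)[OF uD]]
  have "nxt localized (on_obj (later localized) A) =
      on_arr F (nxt M (on_obj G (on_obj F (D ?X))) \<cdot>\<^bsub>S\<^esub> \<eta> (D ?X))"
    by (simp add: localized_simps counit_inverse_of_reflected[OF DX]
        functor_comp_arr[OF F_functor uD nGF])
  also have "\<dots> = on_arr F (Da (\<eta> (D ?X)) \<cdot>\<^bsub>S\<^esub> Da (nxt M ?X))"
    using wp X unfolding nGFD well_pointed_def by simp
  also have "\<dots> = on_arr F (Da (on_arr G (nxt localized A)))"
    unfolding swap functor_comp_arr[OF S.later_functor n uD] ..
  also have "\<dots> = on_arr (later localized) (nxt localized A)"
    by (simp add: localized_simps)
  finally show "on_arr (later localized) (nxt localized A) =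
      nxt localized (on_obj (later localized) A)" ..
qed

text \<open>Transposition along the adjunction carries the closure condition for \<open>u\<close> to the closure condition
  for \<open>G u\<close>, and full faithfulness of \<open>G\<close> brings the section of \<open>G u\<close> back to \<open>u\<close>.\<close>

lemma localized_external_loeb:
  assumes loeb: "external_loeb S M"
  shows "external_loeb T localized"
  unfolding external_loeb_def
proof (intro allI impI, elim conjE)
  fix u
  assume mono: "mono_arr T u" and closed: "later_closed T localized u"
  let ?U = "Dom T u" and ?X = "Cod T u"
  have u: "u \<in> hom T ?U ?X"
    using mono unfolding mono_arr_def by (simp add: hom_DomCod)
  note U = T.hom_obj(1)[OF u] and X = T.hom_obj(2)[OF u]
  note Gu = functor_hom[OF G_functor u]
  note GX = S.hom_obj(2)[OF Gu]
  note n = S.nxt_hom[OF GX]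
  note DGu = functor_hom[OF S.later_functor Gu]
  note i = counit_inverse[OF X] and e = counit_hom[OF X]
  have Gmono: "mono_arr S (on_arr G u)"
    by (rule left_exact_mono[OF T.category_axioms S.category_axioms right_adjoint_left_exact mono])
  have "later_closed S M (on_arr G u)"
    unfolding later_closed_def homD(3)[OF Gu]
  proof (intro allI ballI impI)
    fix Y b
    assume b: "b \<in> hom S Y (on_obj G ?X)"
      and f: "factors_through S (nxt M (on_obj G ?X) \<cdot>\<^bsub>S\<^esub> b) (Da (on_arr G u))"
    note Y = S.hom_obj(1)[OF b]
    note Fb = functor_hom[OF F_functor b] and Fn = functor_hom[OF F_functor n]
    note fb = flat_hom[OF b X]
    \<comment> \<open>In this composite the counit in the transpose cancels its inverse in the localized \<open>next\<close>.\<close>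
    have "nxt localized ?X \<cdot>\<^bsub>T\<^esub> flat ?X b = on_arr F (nxt M (on_obj G ?X) \<cdot>\<^bsub>S\<^esub> b)"
      unfolding localized_simps T.comp_assoc[OF fb i(1) Fn]
      unfolding flat_def T.comp_assoc[OF Fb e i(1), symmetric] i(2) T.ident_comp[OF Fb]
        functor_comp_arr[OF F_functor b n] ..
    moreover have "factors_through T (on_arr F (nxt M (on_obj G ?X) \<cdot>\<^bsub>S\<^esub> b))
        (on_arr F (Da (on_arr G u)))"
      by (rule functor_factors[OF F_functor f S.comp_hom[OF b n] DGu])
    ultimately have "factors_through T (flat ?X b) u"
      using closed fb unfolding later_closed_def localized_simps(2) by simp
    then obtain c where c: "c \<in> hom T (on_obj F Y) ?U" "u \<cdot>\<^bsub>T\<^esub> c = flat ?X b"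
      by (rule factors_throughE[OF _ fb u])
    have "on_arr G u \<cdot>\<^bsub>S\<^esub> sharp Y c = b"
      using sharp_comp[OF c(1) u Y] c(2) sharp_flat[OF b X] by simp
    then show "factors_through S b (on_arr G u)"
      by (rule factors_throughI[OF sharp_hom[OF c(1) Y] Gu b])
  qed
  then have "factors_through S (Ident S (on_obj G ?X)) (on_arr G u)"
    using loeb Gmono homD(3)[OF Gu] unfolding external_loeb_def by metis
  then obtain s where s: "s \<in> hom S (on_obj G ?X) (on_obj G ?U)"
      "on_arr G u \<cdot>\<^bsub>S\<^esub> s = Ident S (on_obj G ?X)"
    by (rule factors_throughE[OF _ S.ident_hom[OF GX] Gu])
  obtain r where r: "r \<in> hom T ?X ?U" "on_arr G r = s"
    using G_full[OF X U s(1)] .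
  have "u \<cdot>\<^bsub>T\<^esub> r = Ident T ?X"
  proof (rule G_faithful[OF T.comp_hom[OF r(1) u] T.ident_hom[OF X]])
    show "on_arr G (u \<cdot>\<^bsub>T\<^esub> r) = on_arr G (Ident T ?X)"
      using functor_comp_arr[OF G_functor r(1) u] r(2) s(2) functor_ident[OF G_functor X] by simp
  qed
  then show "factors_through T (Ident T ?X) u"
    by (rule factors_throughI[OF r(1) u T.ident_hom[OF X]])
qed

end

lemma later_category_of_universe:
  assumes "geometric_universe C" "later_structure C M"
  shows "later_category C M"
proof -
  interpret category C
    using assms(1) by (simp add: geometric_universe_def elementary_topos_def)
  show ?thesis
    using assms by unfold_locales (simp_all add: geometric_universe_def elementary_topos_def)
qed

theorem theorem3p14:
  fixes S :: "('o, 'm) precategory" and T :: "('p, 'n) precategory"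
    and L :: "('o, 'm, 'p, 'n) morphism_data" and M :: "('o, 'm) later_data"
  assumes "geometric_universe S"
    and "later_structure S M"
    and "left_exact_localization S T L"
  shows "later_structure T (localized_later T L M) \<and>
    (supports_loeb S M \<longrightarrow> supports_loeb T (localized_later T L M)) \<and>
    (sgdt_model S M \<longrightarrow> sgdt_model T (localized_later T L M))"
proof -
  have T: "geometric_universe T"
    and lex: "left_exact S T (inverse_image L)"
    and adj: "adjunction S T (inverse_image L) (direct_image L) (unit_of L) (counit_of L)"
    and ff: "fully_faithful T S (direct_image L)"
    using assms(3) by (simp_all add: left_exact_localization_def geometric_universe_morphism_def)
  have "category S" "category T"
    using assms(1) T by (simp_all add: geometric_universe_def elementary_topos_def)
  then interpret localized_later_structure S T "inverse_image L" "direct_image L" "unit_of L"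
      "counit_of L" M
    by (simp add: localized_later_structure_def later_modality_def later_modality_axioms_def
        localization_def localization_axioms_def adjoint_pair_def adjoint_pair_axioms_def
        lex adj ff assms(2))
  have eq: "localized_later T L M = localized"
    by (simp add: localized_later_def localized_def)
  have loeb: "supports_loeb T localized" if "supports_loeb S M"
    using that localized_external_loeb
      later_category.supports_loeb_iff_external[OF later_category_of_universe[OF assms(1,2)]]
      later_category.supports_loeb_iff_external[OF later_category_of_universe[OF T localized_structure]]
    by simp
  show ?thesis
    unfolding eq
    using localized_structure loeb localized_well_pointed T by (simp add: sgdt_model_def)
qed

end
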